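(* A polarized arrangement $(V,\eta,\xi)$ of $n$ hyperplanes in $k$-space is right cyclic if and only if the polarization reversal of its alt Gale dual, namely the polarized arrangement $(\mathrm{alt}(V^\perp),-\mathrm{alt}(\xi),\mathrm{alt}(\eta))$ of $n$ hyperplanes in $(n-k)$-space, is left cyclic.
   Context: A polarized arrangement of $n$ hyperplanes in $k$-space is a triple $(V,\eta,\xi)$ where $V\subset\mathbb R^n$ is a linear subspace of dimension $k$, $\eta\in\mathbb R^n/V$ is such that every representative in $\mathbb R^n$ has at least $n-k$ nonzero entries, and $\xi\in V^*=(\mathbb R^n)^*/V^\perp$ is such that every representative in $(\mathbb R^n)^*$ has at least $k$ nonzero entries. $\mathrm{Gr}^{>0}_{m,N}$ is the set of $m$-dimensional subspaces of $\mathbb R^N$ whose Plücker coordinates are all nonzero and of the same sign. $\eta$ is positively oriented with respect to $V$ if the first coordinate of the orthogonal projection of some (equivalently every) representative of $\eta$ onto the orthogonal complement of $V$ in $\mathbb R^n$ is positive. A polarized arrangement $(V,\eta,\xi)$ of $n$ hyperplanes in $k$-space is left cyclic if $V+\langle\eta\rangle\in\mathrm{Gr}^{>0}_{k+1,n}$, $\{(\xi(v),v):v\in V\}\in\mathrm{Gr}^{>0}_{k,n+1}$, and $\eta$ is positively oriented with respect to $V$. It is right cyclic if $V+\langle\eta\rangle\in\mathrm{Gr}^{>0}_{k+1,n}$, $\{(v,(-1)^k\xi(v)):v\in V\}\in\mathrm{Gr}^{>0}_{k,n+1}$, and $\eta$ is positively oriented with respect to $V$. (For the dual arrangement, $k$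 is replaced by $n-k$ in these definitions.) Identify $(\mathbb R^n)^*$ with $\mathbb R^n$ by the standard basis, so $V^\perp\subset\mathbb R^n$ is a subspace of dimension $n-k$, $\xi\in\mathbb R^n/V^\perp$, and $\eta\in\mathbb R^n/V=(V^\perp)^*$. The map $\mathrm{alt}$ is the automorphism of $\mathbb R^n$ (and of $(\mathbb R^n)^*$) flipping the sign of all even-index coordinates; $\mathrm{alt}(\xi)$ is the class in $\mathbb R^n/\mathrm{alt}(V^\perp)$ of $\mathrm{alt}$ of a representative of $\xi$, and $\mathrm{alt}(\eta)$ is the functional on $\mathrm{alt}(V^\perp)$ represented by $\mathrm{alt}$ of a representative of $\eta$. The Gale dual of $(V,\eta,\xi)$ is $(V^\perp,-\xi,-\eta)$; its alt Gale dual is $(\mathrm{alt}(V^\perp),-\mathrm{alt}(\xi),-\mathrm{alt}(\eta))$; polarization reversal sends $(V,\eta,\xi)$ to $(V,\eta,-\xi)$.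
   Formalization: The formal statement assumes 0 < k < n; for k = n (or k = 0) the equivalence fails as defined, e.g. V = R^n, η = 0 and −alt(ξ) with all entries positive: the dual is left cyclic, but the arrangement is not right cyclic because Gr_{n+1,n} is empty. *)

theory Defs
  imports
    "HOL-Algebra.AbelCoset"
    "Jordan_Normal_Form.VS_Connect"
    "Jordan_Normal_Form.Determinant"
    "Jordan_Normal_Form.DL_Submatrix"
begin

section \<open>Subspaces of Euclidean space and the positive Grassmannian\<close>

text \<open>Coordinates of vectors are numbered from \<open>0\<close>. The dual space of \<open>\<real>\<^sup>n\<close> is identified with
  \<open>\<real>\<^sup>n\<close> by the standard basis, that is, by the scalar product \<open>\<bullet>\<close>.\<close>

abbreviation Rn :: "nat \<Rightarrow> (real, real vec) module"
  where "Rn n \<equiv> module_vec TYPE(real) n"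

abbreviation perp :: "nat \<Rightarrow> real vec set \<Rightarrow> real vec set"
  where "perp n W \<equiv> vec_module.orthogonal_complement n W"

definition Gr :: "nat \<Rightarrow> nat \<Rightarrow> real vec set set"
  where "Gr m N = {W. VectorSpace.subspace class_ring W (Rn N) \<and>
    vectorspace.dim class_ring (Rn N \<lparr>carrier := W\<rparr>) = m}"

definition plucker :: "real mat \<Rightarrow> nat set \<Rightarrow> real"
  where "plucker A I = det (submatrix A UNIV I)"

text \<open>Plucker coordinates of a subspace are those of a matrix whose rows form a basis of it. A change
  of basis multiplies all of them by the same nonzero number, so it does not matter which basis is
  used. An \<open>m \<times> N\<close> matrix whose rows span an \<open>m\<close>-dimensional space has linearly independent rows.\<close>

definition Gr_pos :: "nat \<Rightarrow> nat \<Rightarrow> real vec set set"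
  where "Gr_pos m N = {W \<in> Gr m N. \<exists>A \<in> carrier_mat m N. vec_space.row_space N A = W \<and>
    ((\<forall>I. I \<subseteq> {..<N} \<and> card I = m \<longrightarrow> plucker A I > 0) \<or>
     (\<forall>I. I \<subseteq> {..<N} \<and> card I = m \<longrightarrow> plucker A I < 0))}"

definition orth_proj :: "real vec set \<Rightarrow> real vec \<Rightarrow> real vec"
  where "orth_proj W x = (THE p. p \<in> W \<and> (\<forall>w \<in> W. (x - p) \<bullet> w = 0))"


section \<open>Polarized arrangements\<close>

text \<open>In a triple \<open>(V, \<eta>, \<xi>)\<close> the classes \<open>\<eta> \<in> \<real>\<^sup>n/V\<close> and \<open>\<xi> \<in> V\<^sup>* = \<real>\<^sup>n/V\<^sup>\<bottom>\<close> are given as cosets, that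
  is, as the sets of all their representatives.\<close>

type_synonym arrangement = "real vec set \<times> real vec set \<times> real vec set"

definition nonzero_entries :: "real vec \<Rightarrow> nat"
  where "nonzero_entries x = card {i. i < dim_vec x \<and> x $ i \<noteq> 0}"

fun polarized_arrangement :: "nat \<Rightarrow> nat \<Rightarrow> arrangement \<Rightarrow> bool"
  where "polarized_arrangement n k (V, \<eta>, \<xi>) \<longleftrightarrow>
    V \<in> Gr k n \<and>
    \<eta> \<in> a_rcosets\<^bsub>Rn n\<^esub> V \<and> (\<forall>e \<in> \<eta>. nonzero_entries e \<ge> n - k) \<and>
    \<xi> \<in> a_rcosets\<^bsub>Rn n\<^esub> (perp n V) \<and> (\<forall>x \<in> \<xi>. nonzero_entries x \<ge> k)"

text \<open>The value at \<open>v \<in> V\<close> of the functional \<open>\<xi>\<close>; every representative gives the same value.\<close>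

definition pairing :: "real vec set \<Rightarrow> real vec \<Rightarrow> real"
  where "pairing \<xi> v = (THE c. \<forall>x \<in> \<xi>. x \<bullet> v = c)"

text \<open>The subspace \<open>V + \<langle>\<eta>\<rangle>\<close>, spanned by \<open>V\<close> and any one representative of \<open>\<eta>\<close>.\<close>

definition extend :: "nat \<Rightarrow> real vec set \<Rightarrow> real vec set \<Rightarrow> real vec set"
  where "extend n V \<eta> = LinearCombinations.module.span class_ring (Rn n) (V \<union> \<eta>)"

definition positively_oriented :: "nat \<Rightarrow> real vec set \<Rightarrow> real vec set \<Rightarrow> bool"
  where "positively_oriented n V \<eta> \<longleftrightarrow> (\<exists>e \<in> \<eta>. orth_proj (perp n V) e $ 0 > 0)"

text \<open>For \<open>k = n\<close> no arrangement is left or right cyclic, since \<open>\<real>\<^sup>n\<close> has no subspace of dimension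
  \<open>n + 1\<close>.\<close>

fun left_cyclic :: "nat \<Rightarrow> nat \<Rightarrow> arrangement \<Rightarrow> bool"
  where "left_cyclic n k (V, \<eta>, \<xi>) \<longleftrightarrow>
    polarized_arrangement n k (V, \<eta>, \<xi>) \<and>
    extend n V \<eta> \<in> Gr_pos (k + 1) n \<and>
    {vCons (pairing \<xi> v) v | v. v \<in> V} \<in> Gr_pos k (n + 1) \<and>
    positively_oriented n V \<eta>"

fun right_cyclic :: "nat \<Rightarrow> nat \<Rightarrow> arrangement \<Rightarrow> bool"
  where "right_cyclic n k (V, \<eta>, \<xi>) \<longleftrightarrow>
    polarized_arrangement n k (V, \<eta>, \<xi>) \<and>
    extend n V \<eta> \<in> Gr_pos (k + 1) n \<and>
    {v @\<^sub>v vec_of_list [(-1) ^ k * pairing \<xi> v] | v. v \<in> V} \<in> Gr_pos k (n + 1) \<and>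
    positively_oriented n V \<eta>"


section \<open>Duality\<close>

text \<open>The sign flips at the even positions of the numbering from \<open>1\<close>, which are the odd positions of
  the numbering from \<open>0\<close>.\<close>

definition alt :: "real vec \<Rightarrow> real vec"
  where "alt v = vec (dim_vec v) (\<lambda>i. (-1) ^ i * v $ i)"

text \<open>The negative of a coset of \<open>W\<close>, and its image under \<open>alt\<close> as a coset of \<open>alt W\<close>, are the
  elementwise images. Note \<open>(V\<^sup>\<bottom>)\<^sup>\<bottom> = V\<close>, so \<open>\<real>\<^sup>n/V = (V\<^sup>\<bottom>)\<^sup>*\<close>.\<close>

fun alt_gale_dual :: "nat \<Rightarrow> arrangement \<Rightarrow> arrangement"
  where "alt_gale_dual n (V, \<eta>, \<xi>) = (alt ` perp n V, uminus ` alt ` \<xi>, uminus ` alt ` \<eta>)"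

fun polarization_reversal :: "arrangement \<Rightarrow> arrangement"
  where "polarization_reversal (V, \<eta>, \<xi>) = (V, \<eta>, uminus ` \<xi>)"

end

theory Submission
  imports Defs "Jordan_Normal_Form.DL_Rank"
begin

text \<open>Complementary minors of a matrix \<open>A\<close> and of a matrix \<open>B\<close> spanning the orthogonal complement of its
  row space agree up to a common factor and the sign \<open>(-1)\<^bsup>\<Sum>j\<^esup>\<close> over the columns \<open>j\<close> of the minor of
  \<open>B\<close>, so \<open>W\<close> is positive iff \<open>alt W\<^sup>\<bottom>\<close> is. Applied to the graph of \<open>alt \<eta>\<close> over \<open>alt V\<^sup>\<bottom>\<close>, this yields the
  matrix with block rows \<open>(1, \<eta>)\<close> and \<open>(0, V)\<close>, whose minors are those of \<open>V\<close> and of \<open>\<eta>, V\<close>: positivity of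
  the graph says that \<open>V\<close> and \<open>V + \<langle>\<eta>\<rangle>\<close> are both positive with coherent signs. By Cauchy--Binet the sign
  linking them is that of the first coordinate of the projection of \<open>\<eta>\<close> to \<open>V\<^sup>\<bottom>\<close>, so coherence is the
  orientation condition. The graph of \<open>(-1)\<^sup>k \<xi>\<close> over \<open>V\<close> is treated alike, so each of the two notions
  of cyclicity becomes the same conjunction of coherence for \<open>(V, \<eta>)\<close> and for the dual pair.\<close>


section \<open>Minors along increasing column selections\<close>

text \<open>Minors of a space are defined only up to a common factor, yet positivity of a graph
  compares the signs of two families. Hence basis matrices are fixed and one factor \<open>s\<close>
  is carried through; duality may make it negative, but it changes both families together.

  Neither notion of cyclicity asks \<open>V\<close> itself to be positive. This comes from the other
  pair: coherence for the dual pair makes the alternated complement definite, hence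
  \<open>V\<close>, and only then does the orientation condition force the signs of \<open>V\<close>
  and of its extension by \<eta> to agree.

  The signs in the definitions depend on where the extra coordinate is placed. In front, it shifts
  the old coordinates by one, so alternating all \<open>n + 1\<close> of them is minus the
  alternation on the old ones. This yields \<open>alt\<close> \<eta> with a plus sign, which
  explains the polarization reversal. At the end, the old coordinates keep their signs and the new
  one receives \<open>(-1) ^ n\<close>. Of this, \<open>(-1) ^ (n - k)\<close> is spent on a Laplace
  expansion, and the rest is the \<open>(-1) ^ k\<close> of right cyclicity.\<close>

definition minor :: "'a :: comm_ring_1 mat \<Rightarrow> (nat \<Rightarrow> nat) \<Rightarrow> 'a"
  where "minor A f = det (mat (dim_row A) (dim_row A) (\<lambda>(i, j). A $$ (i, f j)))"

text \<open>A column set is represented by its increasing enumeration, because the permuted and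
  repeated columns of Cauchy--Binet are then just other functions. Values outside
  \<open>{..<m}\<close> are unconstrained, so two enumerations of one set need to agree only where
  \<open>minor\<close> looks.\<close>

definition incr :: "nat \<Rightarrow> nat \<Rightarrow> (nat \<Rightarrow> nat) \<Rightarrow> bool"
  where "incr m N f \<longleftrightarrow> f ` {..<m} \<subseteq> {..<N} \<and> strict_mono_on {..<m} f"

lemma incr_less: "incr m N f \<Longrightarrow> i < m \<Longrightarrow> f i < N"
  by (auto simp: incr_def)

lemma incr_mono: "incr m N f \<Longrightarrow> i < j \<Longrightarrow> j < m \<Longrightarrow> f i < f j"
  by (auto simp: incr_def strict_mono_on_def)

lemma incr_inj: "incr m N f \<Longrightarrow> inj_on f {..<m}"
  by (auto simp: incr_def intro: strict_mono_on_imp_inj_on)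

lemma incrI:
  assumes "\<And>i. i < m \<Longrightarrow> f i < N" "\<And>i j. i < j \<Longrightarrow> j < m \<Longrightarrow> f i < f j"
  shows "incr m N f"
  using assms by (auto simp: incr_def strict_mono_on_def)

lemma incr_pick:
  assumes "I \<subseteq> {..<N}" "card I = m"
  shows "incr m N (pick I)" "pick I ` {..<m} = I"
proof -
  have fin: "finite I" using assms(1) finite_subset by blast
  have in_I: "pick I i \<in> I" if "i < m" for i
    using pick_in_set_le[of i I] that assms(2) by simp
  show incr: "incr m N (pick I)"
  proof (rule incrI)
    show "pick I i < N" if "i < m" for i using in_I[OF that] assms(1) by auto
    show "pick I i < pick I j" if "i < j" "j < m" for i j
      using pick_mono_le[of j I i] that assms(2) by simp
  qed
  show "pick I ` {..<m} = I"
    by (rule card_subset_eq[OF fin]) (use in_I incr_inj[OF incr] assms(2) in \<open>auto simp: card_image\<close>)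
qed

text \<open>Exactly \<open>j\<close> elements of the image lie below \<open>f j\<close>, and
  \<open>pick\<close> recovers an element from that count.\<close>

lemma pick_image_incr:
  assumes "incr m N f" "j < m"
  shows "pick (f ` {..<m}) j = f j"
proof -
  have "{a \<in> f ` {..<m}. a < f j} = f ` {..<j}"
    using assms by (auto simp: incr_def strict_mono_on_less)
  moreover have "card (f ` {..<j}) = j"
    by (subst card_image) (use incr_inj[OF assms(1)] assms(2) in \<open>auto intro: inj_on_subset\<close>)
  ultimately show ?thesis
    using pick_card_in_set[of "f j" "f ` {..<m}"] assms(2) by auto
qed

lemma minor_cong:
  assumes "\<And>j. j < dim_row A \<Longrightarrow> f j = g j"
  shows "minor A f = minor A g"
  unfolding minor_def by (rule arg_cong[where f = det]) (auto simp: assms intro!: eq_matI)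

lemma plucker_minor:
  assumes A: "A \<in> carrier_mat m N" and I: "I \<subseteq> {..<N}" "card I = m"
  shows "plucker A I = minor A (pick I)"
proof -
  have "{j. j < N \<and> j \<in> I} = I" using I(1) by auto
  then show ?thesis
    using A I(2) by (auto simp: plucker_def minor_def submatrix_def pick_UNIV intro!: arg_cong[where f = det])
qed

text \<open>The bridge from the index sets of \<open>Gr_pos\<close> to enumerations. The predicate
  \<open>P\<close> stays arbitrary in order to serve both signs.\<close>

lemma all_plucker_iff_minor:
  assumes A: "A \<in> carrier_mat m N"
  shows "(\<forall>I. I \<subseteq> {..<N} \<and> card I = m \<longrightarrow> P (plucker A I)) \<longleftrightarrow> (\<forall>f. incr m N f \<longrightarrow> P (minor A f))"
proof (intro iffI allI impI)
  fix f assume *: "\<forall>I. I \<subseteq> {..<N} \<and> card I = m \<longrightarrow> P (plucker A I)" and f: "incr m N f"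
  have "f ` {..<m} \<subseteq> {..<N}" "card (f ` {..<m}) = m"
    using f incr_inj[OF f] by (auto simp: incr_def card_image)
  moreover from this have "plucker A (f ` {..<m}) = minor A f"
    using A by (auto simp: plucker_minor[OF A] pick_image_incr[OF f] intro: minor_cong)
  ultimately show "P (minor A f)" using * by metis
next
  fix I assume "\<forall>f. incr m N f \<longrightarrow> P (minor A f)" "I \<subseteq> {..<N} \<and> card I = m"
  then show "P (plucker A I)" using incr_pick(1) plucker_minor[OF A] by auto
qed

lemma minor_mult:
  assumes "C \<in> carrier_mat m m" "A \<in> carrier_mat m N" "\<And>j. j < m \<Longrightarrow> f j < N"
  shows "minor (C * A) f = det C * minor A f"
proof -
  have "mat m m (\<lambda>(i, j). (C * A) $$ (i, f j)) = C * mat m m (\<lambda>(i, j). A $$ (i, f j))"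
    by (rule eq_matI) (use assms in \<open>auto simp: scalar_prod_def\<close>)
  then show ?thesis using assms unfolding minor_def by (simp add: det_mult[of _ m])
qed

lemma det_permute_cols:
  assumes A: "A \<in> carrier_mat n n" and p: "p permutes {0..<n}"
  shows "det (mat n n (\<lambda>(i, j). A $$ (i, p j))) = signof p * det A"
proof -
  have "mat n n (\<lambda>(i, j). A $$ (i, p j)) = (mat n n (\<lambda>(i, j). A\<^sup>T $$ (p i, j)))\<^sup>T"
    by (rule eq_matI) (use A permutes_in_image[OF p] in auto)
  then show ?thesis
    using det_permute_rows[OF _ p, of "A\<^sup>T"] det_transpose[OF A] 
      det_transpose[of "mat n n (\<lambda>(i, j). A\<^sup>T $$ (p i, j))" n] A by simp
qed

lemma minor_permute:
  assumes "p permutes {0..<dim_row A}"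
  shows "minor A (f \<circ> p) = signof p * minor A f"
proof -
  have "mat (dim_row A) (dim_row A) (\<lambda>(i, j). A $$ (i, (f \<circ> p) j)) = 
    mat (dim_row A) (dim_row A) (\<lambda>(i, j). mat (dim_row A) (dim_row A) (\<lambda>(i, j). A $$ (i, f j)) $$ (i, p j))"
    by (rule eq_matI) (use permutes_in_image[OF assms] in auto)
  then show ?thesis unfolding minor_def
    by (simp add: det_permute_cols[OF _ assms])
qed

lemma minor_not_inj:
  assumes "\<not> inj_on f {..<dim_row A}"
  shows "minor A f = 0"
proof -
  obtain i j where ij: "i < dim_row A" "j < dim_row A" "i \<noteq> j" "f i = f j"
    using assms by (auto simp: inj_on_def)
  show ?thesis unfolding minor_def
    by (rule det_identical_columns[OF _ ij(3,1,2)]) (use ij in \<open>auto intro!: eq_vecI\<close>)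
qed

text \<open>Sorting: \<open>g\<close> enumerates the image, and \<open>p\<close> records the rank of
  each value \<open>f j\<close> in it.\<close>

lemma inj_eq_incr_permute:
  assumes inj: "inj_on f {..<m}" and ran: "f ` {..<m} \<subseteq> {..<N}"
  obtains g p where "incr m N g" "p permutes {0..<m}" "\<And>j. j < m \<Longrightarrow> f j = (g \<circ> p) j"
proof -
  define I where "I = f ` {..<m}"
  have I: "I \<subseteq> {..<N}" "card I = m" using assms by (auto simp: I_def card_image)
  note g = incr_pick[OF I]
  have bij: "bij_betw (pick I) {..<m} I" using incr_inj[OF g(1)] g(2) by (simp add: bij_betw_def)
  define q where "q = the_inv_into {..<m} (pick I)"
  have bij': "bij_betw q I {..<m}" unfolding q_def by (rule bij_betw_the_inv_into[OF bij])
  have q: "pick I (q x) = x" if "x \<in> I" for x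
    unfolding q_def by (rule f_the_inv_into_f_bij_betw[OF bij]) (use that in auto)
  have bijf: "bij_betw f {..<m} I" using inj by (simp add: bij_betw_def I_def)
  define p where "p j = (if j < m then q (f j) else j)" for j
  have "bij_betw (q \<circ> f) {..<m} {..<m}" by (rule bij_betw_trans[OF bijf bij'])
  then have "bij_betw p {0..<m} {0..<m}"
    by (subst bij_betw_cong[where g = "q \<circ> f"]) (auto simp: p_def atLeast0LessThan)
  then have "p permutes {0..<m}" by (rule bij_imp_permutes) (auto simp: p_def)
  moreover have "f j = (pick I \<circ> p) j" if "j < m" for j
    using that q[of "f j"] by (auto simp: p_def I_def)
  ultimately show ?thesis using that g(1) by blast
qed

text \<open>Sorting the columns costs both minors the same sign, whose square is 1.\<close>

lemma minor_product_eq_incr: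
  assumes "f ` {..<m} \<subseteq> {..<N}" "inj_on f {..<m}"
  obtains g where "incr m N g"
    "\<And>A B :: 'a :: comm_ring_1 mat. dim_row A = m \<Longrightarrow> dim_row B = m \<Longrightarrow> minor A f * minor B f = minor A g * minor B g"
proof -
  obtain g p where g: "incr m N g" and p: "p permutes {0..<m}" and f: "\<And>j. j < m \<Longrightarrow> f j = (g \<circ> p) j"
    using inj_eq_incr_permute[OF assms(2,1)] by blast
  have "minor A f * minor B f = minor A g * minor B g" if "dim_row A = m" "dim_row B = m" for A B :: "'a mat"
  proof -
    have "minor A f = minor A (g \<circ> p)" "minor B f = minor B (g \<circ> p)"
      by (rule minor_cong; use f that in simp)+
    then have "minor A f * minor B f = (signof p * signof p) * (minor A g * minor B g)"
      using minor_permute[of p A g] minor_permute[of p B g] p that by (simp add: algebra_simps)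
    moreover have "signof p * signof p = (1 :: 'a)" by (auto simp: sign_def)
    ultimately show ?thesis by simp
  qed
  with g that show ?thesis by blast
qed


section \<open>The Cauchy--Binet formula\<close>

text \<open>Summing over all column choices rather than increasing ones counts every minor \<open>m!\<close> times.\<close>

lemma Cauchy_Binet:
  fixes X Y :: "'a :: comm_ring_1 mat"
  assumes X: "X \<in> carrier_mat m N" and Y: "Y \<in> carrier_mat m N"
  shows "of_nat (fact m) * det (X * Y\<^sup>T) = (\<Sum>f \<in> {0..<m} \<rightarrow>\<^sub>E {0..<N}. minor X f * minor Y f)"
proof -
  let ?M = "{0..<m}" and ?P = "{p. p permutes {0..<m}}" and ?F = "{0..<m} \<rightarrow>\<^sub>E {0..<N}"
  have "det (X * Y\<^sup>T) = (\<Sum>p\<in>?P. signof p * (\<Prod>i\<in>?M. \<Sum>l\<in>{0..<N}. X $$ (i, l) * Y $$ (p i, l)))"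
    using X Y by (subst det_def'[of _ m]) 
      (auto simp: scalar_prod_def permutes_in_image intro!: sum.cong prod.cong)
  also have "\<dots> = (\<Sum>p\<in>?P. \<Sum>f\<in>?F. signof p * (\<Prod>i\<in>?M. X $$ (i, f i) * Y $$ (p i, f i)))"
    by (simp add: prod_sum_PiE sum_distrib_left)
  also have "\<dots> = (\<Sum>f\<in>?F. (\<Prod>i\<in>?M. X $$ (i, f i)) * (\<Sum>p\<in>?P. signof p * (\<Prod>i\<in>?M. Y $$ (p i, f i))))"
    by (subst sum.swap) (simp add: prod.distrib sum_distrib_left ac_simps)
  also have "\<dots> = (\<Sum>f\<in>?F. (\<Prod>i\<in>?M. X $$ (i, f i)) * minor Y f)"
    using Y by (auto simp: minor_def det_col[of _ m] permutes_in_image intro!: sum.cong prod.cong arg_cong2[where f = "(*)"])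
  finally have det: "det (X * Y\<^sup>T) = (\<Sum>f\<in>?F. (\<Prod>i\<in>?M. X $$ (i, f i)) * minor Y f)" .
  \<comment> \<open>Precomposition with \<open>p\<close> permutes the column choices and multiplies
    the minor of \<open>Y\<close> by \<open>signof p\<close>. Summing over all \<open>p\<close> then
    assembles these signs and the products over \<open>X\<close> into a minor of
    \<open>X\<close>.\<close>
  have perm: "det (X * Y\<^sup>T) = (\<Sum>f\<in>?F. signof p * (\<Prod>i\<in>?M. X $$ (i, f (p i))) * minor Y f)"
    if p: "p permutes ?M" for p
  proof -
    have "bij_betw (\<lambda>f. f \<circ> p) ?F ?F"
      by (rule bij_betwI[where g = "\<lambda>f. f \<circ> Hilbert_Choice.inv p"])
        (use p permutes_inv[OF p] in \<open>auto simp: PiE_iff extensional_def permutes_in_image permutes_not_in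
          permutes_inv_o o_assoc[symmetric] simp del: o_apply\<close>, auto simp: permutes_not_in permutes_in_image)
    then have "det (X * Y\<^sup>T) = (\<Sum>f\<in>?F. (\<Prod>i\<in>?M. X $$ (i, (f \<circ> p) i)) * minor Y (f \<circ> p))"
      unfolding det by (rule sum.reindex_bij_betw[symmetric])
    also have "\<dots> = (\<Sum>f\<in>?F. signof p * (\<Prod>i\<in>?M. X $$ (i, f (p i))) * minor Y f)"
      using minor_permute[of p Y] p Y by (simp add: ac_simps)
    finally show ?thesis .
  qed
  have "of_nat (fact m) * det (X * Y\<^sup>T) = (\<Sum>p\<in>?P. det (X * Y\<^sup>T))"
    by (simp add: card_permutations)
  also have "\<dots> = (\<Sum>p\<in>?P. \<Sum>f\<in>?F. signof p * (\<Prod>i\<in>?M. X $$ (i, f (p i))) * minor Y f)"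
    by (rule sum.cong) (use perm in auto)
  also have "\<dots> = (\<Sum>f\<in>?F. (\<Sum>p\<in>?P. signof p * (\<Prod>i\<in>?M. X $$ (i, f (p i)))) * minor Y f)"
    by (subst sum.swap) (simp add: sum_distrib_right)
  also have "\<dots> = (\<Sum>f\<in>?F. minor X f * minor Y f)"
    using X by (auto simp: minor_def det_def'[of _ m] permutes_in_image intro!: sum.cong prod.cong arg_cong2[where f = "(*)"])
  finally show ?thesis .
qed

text \<open>Only increasing selections need a sign check: a choice with repeated columns contributes
  0, any other the same as its sorted version. One strict term decides the sign, and
  \<open>c\<close> absorbs the signs of the two families.\<close>

lemma Cauchy_Binet_pos:
  fixes X Y :: "real mat"
  assumes X: "X \<in> carrier_mat m N" and Y: "Y \<in> carrier_mat m N"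
    and nonneg: "\<And>f. incr m N f \<Longrightarrow> c * (minor X f * minor Y f) \<ge> 0"
    and f0: "incr m N f0" "c * (minor X f0 * minor Y f0) > 0"
  shows "c * det (X * Y\<^sup>T) > 0"
proof -
  let ?F = "{0..<m} \<rightarrow>\<^sub>E {0..<N}"
  have nn: "c * (minor X f * minor Y f) \<ge> 0" if "f \<in> ?F" for f
  proof (cases "inj_on f {..<m}")
    case True
    have "f ` {..<m} \<subseteq> {..<N}" using that by auto
    then obtain g where "incr m N g" "minor X f * minor Y f = minor X g * minor Y g"
      using minor_product_eq_incr[OF _ True, of N] X Y by (metis carrier_matD(1))
    then show ?thesis using nonneg by simp
  next
    case False
    then show ?thesis using minor_not_inj[of f X] X by simp
  qed
  \<comment> \<open>The sum runs over extensional functions, so \<open>f0\<close> occurs in it only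
    after restriction.\<close>
  have "restrict f0 {0..<m} \<in> ?F" using incr_less[OF f0(1)] by auto
  moreover have "minor X (restrict f0 {0..<m}) = minor X f0" "minor Y (restrict f0 {0..<m}) = minor Y f0"
    by (rule minor_cong; use X Y in simp)+
  ultimately have "(\<Sum>f\<in>?F. c * (minor X f * minor Y f)) > 0"
    using f0(2) nn by (intro sum_pos2[of _ "restrict f0 {0..<m}"]) (auto intro!: finite_PiE)
  then have "c * (of_nat (fact m) * det (X * Y\<^sup>T)) > 0"
    unfolding Cauchy_Binet[OF X Y] by (simp add: sum_distrib_left)
  then show ?thesis by (simp add: zero_less_mult_iff mult_less_0_iff)
qed

text \<open>Up to a positive factor the Gram determinant is a sum of squared minors. Its
  nonvanishing is the form in which full row rank is carried along.\<close>

lemma gram_det_nonzero_iff_minor: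
  fixes X :: "real mat"
  assumes X: "X \<in> carrier_mat m N"
  shows "det (X * X\<^sup>T) \<noteq> 0 \<longleftrightarrow> (\<exists>f. incr m N f \<and> minor X f \<noteq> 0)"
proof
  assume "\<exists>f. incr m N f \<and> minor X f \<noteq> 0"
  then obtain f where "incr m N f" "minor X f \<noteq> 0" by blast
  then have "1 * det (X * X\<^sup>T) > 0"
    by (intro Cauchy_Binet_pos[OF X X]) (auto simp: zero_less_mult_iff)
  then show "det (X * X\<^sup>T) \<noteq> 0" by simp
next
  assume nz: "det (X * X\<^sup>T) \<noteq> 0"
  show "\<exists>f. incr m N f \<and> minor X f \<noteq> 0"
  proof (rule ccontr)
    assume *: "\<nexists>f. incr m N f \<and> minor X f \<noteq> 0"
    have "minor X f * minor X f = 0" if "f \<in> {0..<m} \<rightarrow>\<^sub>E {0..<N}" for f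
    proof (cases "inj_on f {..<m}")
      case True
      have "f ` {..<m} \<subseteq> {..<N}" using that by auto
      then obtain g where "incr m N g" "minor X f * minor X f = minor X g * minor X g"
        using minor_product_eq_incr[OF _ True, of N] X by (metis carrier_matD(1))
      then show ?thesis using * by simp
    next
      case False
      then show ?thesis using minor_not_inj[of f X] X by simp
    qed
    then have "of_nat (fact m) * det (X * X\<^sup>T) = 0" using Cauchy_Binet[OF X X] by simp
    with nz show False by simp
  qed
qed


section \<open>Minors of orthogonal complements\<close>

text \<open>Stacked below a matrix with \<open>r\<close> fewer rows than columns, these rows delete
  the columns \<open>g\<close> and turn a maximal minor into a square determinant.\<close>

definition unit_rows :: "nat \<Rightarrow> nat \<Rightarrow> (nat \<Rightarrow> nat) \<Rightarrow> 'a :: zero_neq_one mat"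
  where "unit_rows r N g = mat r N (\<lambda>(i, j). if j = g i then 1 else 0)"

lemma incr_full:
  assumes "incr m m f" "j < m"
  shows "f j = j"
proof -
  have "incr m m (\<lambda>i. i)" by (rule incrI) auto
  then have "pick ((\<lambda>i. i) ` {..<m}) j = j" by (rule pick_image_incr) fact
  moreover have "f ` {..<m} = {..<m}"
    by (rule card_subset_eq) (use assms(1) incr_inj[OF assms(1)] in \<open>auto simp: incr_def card_image\<close>)
  ultimately show ?thesis using pick_image_incr[OF assms] by simp
qed

text \<open>Induction on \<open>r\<close>, expanding along the last row, whose only nonzero entry
  sits in column \<open>g r\<close>. As this is the largest deleted column, the earlier ones keep
  their numbers and only \<open>f\<close> must be renumbered.\<close>

lemma det_append_unit_rows:
  fixes A :: "'a :: comm_ring_1 mat"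
  assumes "A \<in> carrier_mat m (m + r)" "incr m (m + r) f" "incr r (m + r) g"
    and "f ` {..<m} \<inter> g ` {..<r} = {}"
  shows "det (A @\<^sub>r unit_rows r (m + r) g) = (-1) ^ (\<Sum>t<r. m + t + g t) * minor A f"
  using assms
proof (induction r arbitrary: A f)
  case 0
  have A: "A \<in> carrier_mat m m" using "0.prems"(1) by simp
  have f: "f j = j" if "j < m" for j using incr_full "0.prems"(2) that by simp
  have "A @\<^sub>r unit_rows 0 m g = mat m m (\<lambda>(i, j). A $$ (i, f j))"
    by (rule eq_matI) (use A f in \<open>auto simp: append_rows_def unit_rows_def\<close>)
  then show ?case using "0.prems"(1) by (simp add: minor_def)
next
  case (Suc r)
  let ?N = "m + Suc r"
  define q where "q = g r"
  define M where "M = A @\<^sub>r unit_rows (Suc r) ?N g"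
  define A' where "A' = mat m (m + r) (\<lambda>(i, j). A $$ (i, if j < q then j else Suc j))"
  \<comment> \<open>The selection \<open>f\<close> as seen after column \<open>q\<close> has been
    removed.\<close>
  define f' where "f' i = (if f i < q then f i else f i - 1)" for i
  note A = Suc.prems(1) and f = Suc.prems(2) and g = Suc.prems(3)
  have M: "M \<in> carrier_mat ?N ?N" using A by (auto simp: M_def append_rows_def unit_rows_def)
  have q: "q < ?N" using incr_less[OF g, of r] by (simp add: q_def)
  have gq: "g t < q" if "t < r" for t using incr_mono[OF g that] by (simp add: q_def)
  have fq: "f i \<noteq> q" if "i < m" for i using Suc.prems(4) that by (auto simp: q_def)
  have f': "incr m (m + r) f'"
  proof (rule incrI)
    show "f' i < m + r" if "i < m" for i
      using incr_less[OF f that] fq[OF that] q by (auto simp: f'_def)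
    show "f' i < f' j" if "i < j" "j < m" for i j
      using incr_mono[OF f that] fq[of i] fq[of j] that by (auto simp: f'_def)
  qed
  have g': "incr r (m + r) g"
    by (rule incrI) (use gq q incr_mono[OF g] in \<open>auto dest: less_trans\<close>, fastforce)
  have "f' i \<noteq> g t" if "i < m" "t < r" for i t
  proof -
    have "f i \<noteq> g t" using Suc.prems(4) that by (auto simp: disjoint_iff)
    then show ?thesis using gq[OF that(2)] fq[OF that(1)] by (auto simp: f'_def)
  qed
  then have disj: "f' ` {..<m} \<inter> g ` {..<r} = {}" by auto
  have A': "A' \<in> carrier_mat m (m + r)" by (simp add: A'_def)
  have minor: "minor A' f' = minor A f"
  proof -
    have "(if f' j < q then f' j else Suc (f' j)) = f j" if "j < m" for j
      using fq[OF that] by (auto simp: f'_def)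
    then show ?thesis using A incr_less[OF f']
      by (auto simp: minor_def A'_def intro!: arg_cong[where f = det] eq_matI)
  qed
  have del: "mat_delete M (m + r) q = A' @\<^sub>r unit_rows r (m + r) g"
  proof (rule eq_matI)
    fix i j assume "i < dim_row (A' @\<^sub>r unit_rows r (m + r) g)" "j < dim_col (A' @\<^sub>r unit_rows r (m + r) g)"
    then have ij: "i < m + r" "j < m + r" by (auto simp: append_rows_def A'_def unit_rows_def)
    then have "i < m \<or> i - m < r \<and> g (i - m) < q" using gq[of "i - m"] by auto
    show "mat_delete M (m + r) q $$ (i, j) = (A' @\<^sub>r unit_rows r (m + r) g) $$ (i, j)"
      using ij A \<open>i < m \<or> i - m < r \<and> g (i - m) < q\<close>
      by (auto simp: mat_delete_def M_def append_rows_def A'_def unit_rows_def)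
  qed (use A in \<open>auto simp: M_def append_rows_def A'_def unit_rows_def\<close>)
  have "det M = (\<Sum>j<?N. M $$ (m + r, j) * cofactor M (m + r) j)"
    by (rule laplace_expansion_row[OF M]) simp
  also have "\<dots> = (\<Sum>j<?N. if j = q then cofactor M (m + r) j else 0)"
    using A by (intro sum.cong) (auto simp: M_def append_rows_def unit_rows_def q_def)
  also have "\<dots> = cofactor M (m + r) q" using q by simp
  also have "\<dots> = (-1) ^ (m + r + q) * ((-1) ^ (\<Sum>t<r. m + t + g t) * minor A f)"
    unfolding cofactor_def del Suc.IH[OF A' f' g' disj] minor ..
  also have "\<dots> = (-1) ^ (\<Sum>t<Suc r. m + t + g t) * minor A f"
    by (simp add: power_add q_def)
  finally show ?case by (simp add: M_def)
qed

lemma complementary_incr: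
  assumes f: "incr m (m + r) f"
  obtains g where "incr r (m + r) g" "f ` {..<m} \<inter> g ` {..<r} = {}"
proof -
  let ?I = "{..<m + r} - f ` {..<m}"
  have "card ?I = r"
    using f incr_inj[OF f] by (subst card_Diff_subset) (auto simp: incr_def card_image)
  then have "incr r (m + r) (pick ?I)" "pick ?I ` {..<r} = ?I"
    using incr_pick[of ?I "m + r" r] by auto
  with that[of "pick ?I"] show ?thesis by auto
qed

lemma append_rows_mult_transpose:
  fixes A :: "'a :: comm_ring_1 mat"
  assumes "A \<in> carrier_mat m N" "B \<in> carrier_mat r N" "C \<in> carrier_mat m' N" "D \<in> carrier_mat r' N"
  shows "(A @\<^sub>r B) * (C @\<^sub>r D)\<^sup>T = four_block_mat (A * C\<^sup>T) (A * D\<^sup>T) (B * C\<^sup>T) (B * D\<^sup>T)"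
proof -
  have "(A @\<^sub>r B) * (C @\<^sub>r D)\<^sup>T = four_block_mat A (0\<^sub>m m 0) B (0\<^sub>m r 0) *
    four_block_mat C\<^sup>T D\<^sup>T (0\<^sub>m 0 m') (0\<^sub>m 0 r')"
    using assms by (simp add: append_rows_def transpose_four_block_mat[of _ m' N _ 0 _ r'])
  also have "\<dots> = four_block_mat (A * C\<^sup>T) (A * D\<^sup>T) (B * C\<^sup>T) (B * D\<^sup>T)"
    using assms by (subst mult_four_block_mat[where ?n1.0 = N and ?n2.0 = 0]) auto
  finally show ?thesis .
qed

text \<open>Orthogonality makes the Gram matrix of the stack block diagonal. Hence the stack is
  invertible exactly when both blocks have full rank.\<close>

lemma det_append_rows_orthogonal:
  fixes A :: "'a :: idom mat"
  assumes A: "A \<in> carrier_mat m (m + r)" and B: "B \<in> carrier_mat r (m + r)"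
    and orth: "A * B\<^sup>T = 0\<^sub>m m r"
  shows "det (A @\<^sub>r B) * det (A @\<^sub>r B) = det (A * A\<^sup>T) * det (B * B\<^sup>T)"
proof -
  have AB: "A @\<^sub>r B \<in> carrier_mat (m + r) (m + r)" using A B by auto
  have "det (A @\<^sub>r B) * det (A @\<^sub>r B) = det ((A @\<^sub>r B) * (A @\<^sub>r B)\<^sup>T)"
    using det_mult[OF AB, of "(A @\<^sub>r B)\<^sup>T"] det_transpose[OF AB] AB by simp
  also have "\<dots> = det (A * A\<^sup>T) * det (B * B\<^sup>T)"
    using A B by (simp add: append_rows_mult_transpose orth det_four_block_mat_upper_right_zero[of _ m _ r])
  finally show ?thesis .
qed

definition alt_mat :: "'a :: comm_ring_1 mat \<Rightarrow> 'a mat"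
  where "alt_mat A = mat (dim_row A) (dim_col A) (\<lambda>(i, j). (-1) ^ j * A $$ (i, j))"

lemma alt_mat_carrier[simp]: "alt_mat A \<in> carrier_mat m N \<longleftrightarrow> A \<in> carrier_mat m N"
  unfolding alt_mat_def carrier_mat_def by simp

lemma minor_alt_mat:
  assumes "A \<in> carrier_mat m N" "\<And>j. j < m \<Longrightarrow> f j < N"
  shows "minor (alt_mat A) f = (-1) ^ (\<Sum>j<m. f j) * minor A f"
proof -
  let ?A = "mat m m (\<lambda>(i, j). A $$ (i, f j))"
  have "mat m m (\<lambda>(i, j). alt_mat A $$ (i, f j)) = ?A * mat_diag m (\<lambda>j. (-1) ^ f j)"
    by (subst mat_diag_mult_right[of _ m]) (use assms in \<open>auto simp: alt_mat_def intro!: eq_matI\<close>)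
  moreover have "det (mat_diag m (\<lambda>j. (-1) ^ f j) :: 'a mat) = (-1) ^ (\<Sum>j<m. f j)"
    by (subst det_upper_triangular[of _ m])
      (auto simp: mat_diag_def diag_mat_def power_sum prod.list_conv_set_nth atLeast0LessThan interv_sum_list_conv_sum_set_nat
        simp flip: prod.distinct_set_conv_list)
  ultimately show ?thesis
    using assms by (auto simp: minor_def det_mult[of _ m] alt_mat_def)
qed

definition pos_minors :: "real \<Rightarrow> real mat \<Rightarrow> bool"
  where "pos_minors s A \<longleftrightarrow> (\<forall>f. incr (dim_row A) (dim_col A) f \<longrightarrow> s * minor A f > 0)"

text \<open>Complete \<open>A\<close> by the unit rows of \<open>g\<close> and multiply by the
  transpose of the stack of \<open>A\<close> and \<open>B\<close>. The product is block triangular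
  because the rows of \<open>A\<close> and \<open>B\<close> are orthogonal, and its determinant
  relates the minor of \<open>A\<close> at \<open>f\<close> to that of \<open>B\<close> at
  \<open>g\<close>. The part of the sign that depends on the columns is what \<open>alt_mat\<close>
  puts into the minors of \<open>B\<close>. The rest is one constant \<open>c\<close> of unknown
  sign, so the claim compares \<open>s\<close> with \<open>c * s\<close>.\<close>

lemma pos_minors_dual:
  assumes A: "A \<in> carrier_mat m N" and B: "B \<in> carrier_mat r N" and N: "N = m + r"
    and orth: "A * B\<^sup>T = 0\<^sub>m m r" and rkA: "det (A * A\<^sup>T) \<noteq> 0" and rkB: "det (B * B\<^sup>T) \<noteq> 0"
  obtains c where "c \<noteq> 0" "\<And>s. pos_minors s A \<longleftrightarrow> pos_minors (c * s) (alt_mat B)"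
proof -
  define \<delta> where "\<delta> = det (A @\<^sub>r B)"
  \<comment> \<open>The part of the sign in \<open>det_append_unit_rows\<close> that is the same for
    all column selections.\<close>
  define \<kappa> :: real where "\<kappa> = (-1) ^ (\<Sum>t<r. m + t)"
  have AB: "A @\<^sub>r B \<in> carrier_mat N N" using A B N by auto
  have \<delta>: "\<delta> \<noteq> 0"
    using det_append_rows_orthogonal[of A m r B] A B N orth rkA rkB by (auto simp: \<delta>_def)
  have rel: "\<kappa> * \<delta> * minor A f = det (A * A\<^sup>T) * minor (alt_mat B) g"
    if f: "incr m N f" and g: "incr r N g" and disj: "f ` {..<m} \<inter> g ` {..<r} = {}" for f g
  proof -
    let ?E = "unit_rows r N g :: real mat"
    have E: "?E \<in> carrier_mat r N" by (simp add: unit_rows_def)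
    have "?E * B\<^sup>T = (mat r r (\<lambda>(i, j). B $$ (i, g j)))\<^sup>T"
      by (rule eq_matI) (use B incr_less[OF g] in \<open>auto simp: unit_rows_def scalar_prod_def if_distrib[of "\<lambda>x. x * _"] cong: if_cong\<close>)
    then have EB: "det (?E * B\<^sup>T) = minor B g"
      using B by (simp add: minor_def det_transpose[of _ r])
    have "det (A @\<^sub>r ?E) * \<delta> = det ((A @\<^sub>r ?E) * (A @\<^sub>r B)\<^sup>T)"
      using AB A E N by (simp add: det_mult[of _ N] det_transpose \<delta>_def)
    also have "\<dots> = det (A * A\<^sup>T) * minor B g"
      using A B E EB
      by (simp add: append_rows_mult_transpose[OF A E] orth det_four_block_mat_upper_right_zero[of _ m _ r])
    finally have prod: "(-1) ^ (\<Sum>t<r. m + t + g t) * minor A f * \<delta> = det (A * A\<^sup>T) * minor B g"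
      using det_append_unit_rows[of A m r f g] A f g disj N by simp
    define \<epsilon> :: real where "\<epsilon> = (-1) ^ (\<Sum>t<r. g t)"
    have \<epsilon>: "\<epsilon> * \<epsilon> = 1" by (simp add: \<epsilon>_def flip: power_mult_distrib)
    have "(-1 :: real) ^ (\<Sum>t<r. m + t + g t) = \<kappa> * \<epsilon>"
      by (simp add: \<kappa>_def \<epsilon>_def sum.distrib power_add)
    then have "\<epsilon> * \<epsilon> * (\<kappa> * \<delta> * minor A f) = \<epsilon> * (det (A * A\<^sup>T) * minor B g)"
      using prod by (simp add: ac_simps)
    moreover have "minor (alt_mat B) g = \<epsilon> * minor B g"
      using minor_alt_mat[OF B] incr_less[OF g] by (simp add: \<epsilon>_def)
    ultimately show ?thesis by (simp add: \<epsilon> ac_simps)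
  qed
  define c where "c = det (A * A\<^sup>T) / (\<kappa> * \<delta>)"
  have "\<kappa> \<noteq> 0" by (simp add: \<kappa>_def)
  then have c: "c \<noteq> 0" using rkA \<delta> by (simp add: c_def)
  have rel': "minor A f = c * minor (alt_mat B) g"
    if "incr m N f" "incr r N g" "f ` {..<m} \<inter> g ` {..<r} = {}" for f g
    using rel[OF that] \<open>\<kappa> \<noteq> 0\<close> \<delta> by (simp add: c_def field_simps)
  have "pos_minors s A \<longleftrightarrow> pos_minors (c * s) (alt_mat B)" for s
  proof
    assume pos: "pos_minors s A"
    show "pos_minors (c * s) (alt_mat B)" unfolding pos_minors_def
    proof (intro allI impI)
      fix g assume "incr (dim_row (alt_mat B)) (dim_col (alt_mat B)) g"
      then have g: "incr r N g" using B by (simp add: alt_mat_def)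
      then obtain f where "incr m N f" "f ` {..<m} \<inter> g ` {..<r} = {}"
        using complementary_incr[of r m g] by (metis N add.commute inf_commute)
      then show "c * s * minor (alt_mat B) g > 0"
        using rel'[of f g] g pos A by (auto simp: pos_minors_def mult.assoc mult.left_commute)
    qed
  next
    assume pos: "pos_minors (c * s) (alt_mat B)"
    show "pos_minors s A" unfolding pos_minors_def
    proof (intro allI impI)
      fix f assume "incr (dim_row A) (dim_col A) f"
      then have f: "incr m N f" using A by simp
      then obtain g where g: "incr r N g" "f ` {..<m} \<inter> g ` {..<r} = {}"
        using complementary_incr[of m r f] N by blast
      then have "c * s * minor (alt_mat B) g > 0"
        using pos B by (simp add: pos_minors_def alt_mat_def)
      then show "s * minor A f > 0"
        using rel'[OF f g] by (simp add: mult.assoc mult.left_commute)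
    qed
  qed
  with c that show ?thesis by blast
qed


section \<open>Row spaces and the positive Grassmannian\<close>

lemma row_space_conv:
  fixes A :: "'a :: field mat"
  assumes "A \<in> carrier_mat m N"
  shows "vec_space.row_space N A = (\<lambda>y. A\<^sup>T *\<^sub>v y) ` carrier_vec m"
  using assms by (auto simp: vec_space.row_space_eq)

lemma row_in_row_space:
  fixes A :: "'a :: field mat"
  assumes A: "A \<in> carrier_mat m N" and "i < m"
  shows "row A i \<in> vec_space.row_space N A"
proof -
  have "row A i = A\<^sup>T *\<^sub>v unit_vec m i"
    by (rule eq_vecI) (use assms in \<open>auto\<close>)
  then show ?thesis unfolding row_space_conv[OF A] by auto
qed

lemma row_space_subset_imp_mult:
  fixes A B :: "'a :: field mat"
  assumes A: "A \<in> carrier_mat m N" and B: "B \<in> carrier_mat r N"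
    and sub: "vec_space.row_space N A \<subseteq> vec_space.row_space N B"
  obtains C where "C \<in> carrier_mat m r" "A = C * B"
proof -
  have "\<forall>i<m. \<exists>y \<in> carrier_vec r. row A i = B\<^sup>T *\<^sub>v y"
    using row_in_row_space[OF A] sub unfolding row_space_conv[OF B] by auto
  then obtain y where y: "\<And>i. i < m \<Longrightarrow> y i \<in> carrier_vec r" "\<And>i. i < m \<Longrightarrow> row A i = B\<^sup>T *\<^sub>v y i"
    by metis
  define C where "C = mat\<^sub>r m r y"
  have C: "C \<in> carrier_mat m r" by (simp add: C_def)
  have "A = C * B"
  proof (rule eq_matI)
    fix i j assume ij: "i < dim_row (C * B)" "j < dim_col (C * B)"
    then have "i < m" "j < N" using C B by auto
    then have "A $$ (i, j) = (B\<^sup>T *\<^sub>v y i) $ j" using y(2)[of i] A by (metis carrier_matD index_row(1))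
    also have "\<dots> = y i \<bullet> col B j" using \<open>i < m\<close> \<open>j < N\<close> y(1) B
      by (auto simp: comm_scalar_prod[of _ r])
    also have "\<dots> = (C * B) $$ (i, j)" using ij y(1)[OF \<open>i < m\<close>] C \<open>i < m\<close> by (simp add: C_def)
    finally show "A $$ (i, j) = (C * B) $$ (i, j)" .
  qed (use A B C in auto)
  with C that show ?thesis by blast
qed

text \<open>A change of basis \<open>C\<close> multiplies every minor by \<open>det C\<close>. As
  \<open>m \<le> N\<close>, some selection exists, and its nonzero minor forces
  \<open>det C \<noteq> 0\<close>.\<close>

lemma pos_minors_same_row_space:
  assumes A: "A \<in> carrier_mat m N" and B: "B \<in> carrier_mat m N" and "m \<le> N"
    and eq: "vec_space.row_space N A = vec_space.row_space N B" and pos: "pos_minors s A"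
  obtains c where "c \<noteq> 0" "pos_minors (s * c) B"
proof -
  obtain C where C: "C \<in> carrier_mat m m" "A = C * B"
    using row_space_subset_imp_mult[OF A B] eq by blast
  have minor: "minor A f = det C * minor B f" if "incr m N f" for f
    using minor_mult[OF C(1) B] incr_less[OF that] C(2) by simp
  have "incr m N (\<lambda>i. i)" by (rule incrI) (use assms(3) in auto)
  then have "det C \<noteq> 0" using pos A minor unfolding pos_minors_def by fastforce
  moreover have "pos_minors (s * det C) B"
    using pos minor A B unfolding pos_minors_def by (auto simp: mult.assoc)
  ultimately show ?thesis using that by blast
qed

lemma scalar_prod_self_eq_0:
  fixes v :: "real vec"
  assumes "v \<in> carrier_vec n" "v \<bullet> v = 0"
  shows "v = 0\<^sub>v n"
  using assms by (intro eq_vecI) (auto simp: scalar_prod_def sum_nonneg_eq_0_iff)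

text \<open>If the Gram matrix kills \<open>y\<close>, then \<open>A\<^sup>T *\<^sub>v y\<close> is
  orthogonal to itself and vanishes, the real scalar product being definite.\<close>

lemma gram_det_nonzero_iff_inj:
  fixes A :: "real mat"
  assumes A: "A \<in> carrier_mat m N"
  shows "det (A * A\<^sup>T) \<noteq> 0 \<longleftrightarrow> (\<forall>y \<in> carrier_vec m. A\<^sup>T *\<^sub>v y = 0\<^sub>v N \<longrightarrow> y = 0\<^sub>v m)"
proof -
  have "(A * A\<^sup>T) *\<^sub>v y = 0\<^sub>v m \<longleftrightarrow> A\<^sup>T *\<^sub>v y = 0\<^sub>v N" if y: "y \<in> carrier_vec m" for y
  proof
    assume "(A * A\<^sup>T) *\<^sub>v y = 0\<^sub>v m"
    then have "y \<bullet> (A *\<^sub>v (A\<^sup>T *\<^sub>v y)) = 0" using A y by (simp add: assoc_mult_mat_vec[of _ m N])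
    then have "(A\<^sup>T *\<^sub>v y) \<bullet> (A\<^sup>T *\<^sub>v y) = 0"
      using A y by (simp add: transpose_vec_mult_scalar[of A m N])
    then show "A\<^sup>T *\<^sub>v y = 0\<^sub>v N" using A y by (intro scalar_prod_self_eq_0) auto
  next
    assume "A\<^sup>T *\<^sub>v y = 0\<^sub>v N"
    then show "(A * A\<^sup>T) *\<^sub>v y = 0\<^sub>v m"
      using A y by (auto simp: assoc_mult_mat_vec[of _ m N] intro!: eq_vecI)
  qed
  then show ?thesis using det_0_iff_vec_prod_zero[of "A * A\<^sup>T" m] A by auto
qed

lemma (in vec_space) dim_row_space:
  assumes A: "A \<in> carrier_mat m n"
    and inj: "\<And>y. y \<in> carrier_vec m \<Longrightarrow> A\<^sup>T *\<^sub>v y = 0\<^sub>v n \<Longrightarrow> y = 0\<^sub>v m"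
  shows "vectorspace.dim class_ring (vs (row_space A)) = m"
proof -
  have At: "A\<^sup>T \<in> carrier_mat n m" using A by simp
  \<comment> \<open>Linear independence concerns the set of rows, in which equal rows would
    collapse. Injectivity excludes them, through the difference of two unit vectors.\<close>
  have dist: "distinct (cols A\<^sup>T)"
  proof (rule ccontr)
    assume "\<not> distinct (cols A\<^sup>T)"
    then obtain i j where ij: "i < m" "j < m" "i \<noteq> j" "row A i = row A j"
      using A by (auto simp: distinct_conv_nth)
    have "A\<^sup>T *\<^sub>v (unit_vec m i - unit_vec m j) = row A i - row A j"
      using A ij(1,2) by (auto simp: mult_minus_distrib_mat_vec[OF At] intro!: eq_vecI)
    also have "\<dots> = 0\<^sub>v n" unfolding ij(4) by (rule minus_cancel_vec) (use A in auto)
    finally have "unit_vec m i - unit_vec m j = (0\<^sub>v m :: 'a vec)" by (intro inj) auto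
    then have "(unit_vec m i - unit_vec m j) $ i = (0\<^sub>v m :: 'a vec) $ i" by simp
    then show False using ij by simp
  qed
  have "lin_indpt (set (cols A\<^sup>T))"
  proof
    assume "lin_dep (set (cols A\<^sup>T))"
    then show False using lin_depE[OF At _ dist] inj by metis
  qed
  then have "rank A\<^sup>T = m" by (rule lin_indpt_full_rank[OF At dist])
  then show ?thesis by (simp add: rank_def row_space_def)
qed

text \<open>A largest independent subset of \<open>W\<close> exists because the ambient dimension
  bounds its size. A vector of \<open>W\<close> outside its span would enlarge it, so it is a basis
  and supplies the rows.\<close>

lemma (in vec_space) subspace_eq_row_space:
  assumes W: "VectorSpace.subspace class_ring W V"
  obtains A where "A \<in> carrier_mat (vectorspace.dim class_ring (vs W)) n" "row_space A = W"
    "\<And>y. y \<in> carrier_vec (vectorspace.dim class_ring (vs W)) \<Longrightarrow> A\<^sup>T *\<^sub>v y = 0\<^sub>v n \<Longrightarrow>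
      y = 0\<^sub>v (vectorspace.dim class_ring (vs W))"
proof -
  have sm: "submodule class_ring W V" using W by (simp add: subspace_def)
  then have WV: "W \<subseteq> carrier_vec n" using submodule.subset by fastforce
  let ?P = "\<lambda>U. U \<subseteq> W \<and> lin_indpt U"
  have "\<exists>U. ?P U \<and> (\<forall>U'. ?P U' \<longrightarrow> card U' \<le> card U)"
  proof (rule ex_has_greatest_nat[where k = "{}" and b = "Suc n"])
    show "?P {}" by (auto simp: lin_dep_def)
    show "\<forall>U. ?P U \<longrightarrow> card U < Suc n"
    proof (intro allI impI)
      fix U assume "?P U"
      then have "card U \<le> dim" using WV by (intro li_le_dim(2)) auto
      then show "card U < Suc n" by (simp add: dim_is_n)
    qed
  qed
  then obtain U where U: "U \<subseteq> W" "lin_indpt U" and max: "\<And>U'. U' \<subseteq> W \<Longrightarrow> lin_indpt U' \<Longrightarrow> card U' \<le> card U"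
    by blast
  have UV: "U \<subseteq> carrier_vec n" using U(1) WV by blast
  have fin: "finite U" using fin_dim_li_fin U(2) UV by auto
  have "span U = W"
  proof
    show "span U \<subseteq> W" using span_is_subset[OF U(1) sm] .
    show "W \<subseteq> span U"
    proof
      fix v assume v: "v \<in> W"
      show "v \<in> span U"
      proof (rule ccontr)
        assume nv: "v \<notin> span U"
        then have "v \<notin> U" using span_mem UV by auto
        then have "lin_indpt (U \<union> {v})" using lin_dep_iff_in_span[of U v] UV U(2) nv v WV by auto
        then have "card (U \<union> {v}) \<le> card U" using max U(1) v by auto
        then show False using \<open>v \<notin> U\<close> fin by simp
      qed
    qed
  qed
  obtain us where us: "set us = U" "distinct us" using finite_distinct_list[OF fin] by blast
  define A where "A = mat_of_rows n us"
  have A: "A \<in> carrier_mat (length us) n" by (simp add: A_def)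
  have rows: "rows A = us" using us UV by (simp add: A_def rows_mat_of_rows)
  have At: "A\<^sup>T \<in> carrier_mat n (length us)" using A by simp
  have sp: "row_space A = W" using \<open>span U = W\<close> us rows by (simp add: row_space_def)
  have inj: "y = 0\<^sub>v (length us)" if "y \<in> carrier_vec (length us)" "A\<^sup>T *\<^sub>v y = 0\<^sub>v n" for y
    using lin_depI[OF At that(1) _ that(2)] us U(2) rows by auto
  have "vectorspace.dim class_ring (vs W) = length us"
    using dim_row_space[OF A inj] sp by simp
  then show ?thesis using that A sp inj by metis
qed

lemma Gr_obtain_basis:
  assumes "W \<in> Gr m N"
  obtains A where "A \<in> carrier_mat m N" "vec_space.row_space N A = W" "det (A * A\<^sup>T) \<noteq> 0"
proof -
  from assms have "VectorSpace.subspace class_ring W (Rn N)"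
    "vectorspace.dim class_ring (Rn N\<lparr>carrier := W\<rparr>) = m" by (auto simp: Gr_def)
  from vec_space.subspace_eq_row_space[OF this(1)] this(2) obtain A where
    "A \<in> carrier_mat m N" "vec_space.row_space N A = W"
    "\<And>y. y \<in> carrier_vec m \<Longrightarrow> A\<^sup>T *\<^sub>v y = 0\<^sub>v N \<Longrightarrow> y = 0\<^sub>v m" by metis
  with that gram_det_nonzero_iff_inj[of A m N] show ?thesis by blast
qed

lemma row_space_in_Gr:
  assumes A: "A \<in> carrier_mat m N" and rk: "det (A * A\<^sup>T) \<noteq> 0"
  shows "vec_space.row_space N A \<in> Gr m N"
proof -
  interpret vec_space "TYPE(real)" N .
  have "set (rows A) \<subseteq> carrier_vec N" using A by (auto simp: rows_def)
  then have "VectorSpace.subspace class_ring (row_space A) V"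
    unfolding row_space_def by (intro span_is_subspace) simp
  moreover have "vectorspace.dim class_ring (vs (row_space A)) = m"
    by (rule dim_row_space[OF A]) (use rk gram_det_nonzero_iff_inj[OF A] in blast)
  ultimately show ?thesis by (simp add: Gr_def)
qed

lemma pos_minors_gram_det:
  assumes A: "A \<in> carrier_mat m N" and "m \<le> N" and pos: "pos_minors s A"
  shows "det (A * A\<^sup>T) \<noteq> 0"
proof -
  have "incr m N (\<lambda>i. i)" by (rule incrI) (use assms(2) in auto)
  then show ?thesis using pos A unfolding gram_det_nonzero_iff_minor[OF A] pos_minors_def by fastforce
qed

text \<open>\<open>Gr_pos\<close> asks for one suitable basis matrix. A change of basis carries the
  condition to the given \<open>A\<close>, with the unknown factor absorbed by \<open>s\<close>.
  Under \<open>m \<le> N\<close> the condition on minors is not vacuous and yields full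
  rank.\<close>

lemma row_space_in_Gr_pos_iff:
  assumes A: "A \<in> carrier_mat m N" and mN: "m \<le> N"
  shows "vec_space.row_space N A \<in> Gr_pos m N \<longleftrightarrow> (\<exists>s. s \<noteq> 0 \<and> pos_minors s A)"
proof
  assume "vec_space.row_space N A \<in> Gr_pos m N"
  then obtain B where B: "B \<in> carrier_mat m N" "vec_space.row_space N B = vec_space.row_space N A"
    and "(\<forall>I. I \<subseteq> {..<N} \<and> card I = m \<longrightarrow> plucker B I > 0) \<or>
     (\<forall>I. I \<subseteq> {..<N} \<and> card I = m \<longrightarrow> plucker B I < 0)" by (auto simp: Gr_pos_def)
  from this(3) have "pos_minors 1 B \<or> pos_minors (-1) B"
    using B(1) all_plucker_iff_minor[OF B(1), of "\<lambda>x. x > 0"] all_plucker_iff_minor[OF B(1), of "\<lambda>x. x < 0"]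
    by (simp add: pos_minors_def)
  then obtain s where "s \<noteq> 0" "pos_minors s B" by (metis zero_neq_neg_one zero_neq_one)
  obtain c where "c \<noteq> 0" "pos_minors (s * c) A"
    by (rule pos_minors_same_row_space[OF B(1) A mN B(2) \<open>pos_minors s B\<close>])
  then show "\<exists>s. s \<noteq> 0 \<and> pos_minors s A" using \<open>s \<noteq> 0\<close> by (intro exI[of _ "s * c"]) simp
next
  assume "\<exists>s. s \<noteq> 0 \<and> pos_minors s A"
  then obtain s where s: "s \<noteq> 0" "pos_minors s A" by blast
  have "(\<forall>f. incr m N f \<longrightarrow> minor A f > 0) \<or> (\<forall>f. incr m N f \<longrightarrow> minor A f < 0)"
    using s A by (cases "s > 0") (auto simp: pos_minors_def zero_less_mult_iff)
  then have "(\<forall>I. I \<subseteq> {..<N} \<and> card I = m \<longrightarrow> plucker A I > 0) \<or>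
     (\<forall>I. I \<subseteq> {..<N} \<and> card I = m \<longrightarrow> plucker A I < 0)"
    using all_plucker_iff_minor[OF A, of "\<lambda>x. x > 0"] all_plucker_iff_minor[OF A, of "\<lambda>x. x < 0"] by simp
  then show "vec_space.row_space N A \<in> Gr_pos m N"
    using A row_space_in_Gr[OF A pos_minors_gram_det[OF A mN s(2)]] by (auto simp: Gr_pos_def)
qed


section \<open>Orientation and bordered matrices\<close>

definition row_cons :: "'a vec \<Rightarrow> 'a mat \<Rightarrow> 'a mat"
  where "row_cons x A = mat (Suc (dim_row A)) (dim_col A) (\<lambda>(i, j). if i = 0 then x $ j else A $$ (i - 1, j))"

lemma row_cons_carrier[simp]: "row_cons x A \<in> carrier_mat (Suc m) N \<longleftrightarrow> A \<in> carrier_mat m N"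
  unfolding row_cons_def carrier_mat_def by simp

lemma dim_row_cons[simp]: "dim_row (row_cons x A) = Suc (dim_row A)" "dim_col (row_cons x A) = dim_col A"
  by (simp_all add: row_cons_def)

text \<open>The added vector is a combination of rows of \<open>A\<close>. This allows a
  representative of \<eta> to be replaced by its component orthogonal to \<open>V\<close>.\<close>

lemma minor_row_cons_add:
  fixes A :: "'a :: idom mat"
  assumes A: "A \<in> carrier_mat m N" and x: "x \<in> carrier_vec N" and y: "y \<in> carrier_vec m"
    and f: "\<And>j. j < Suc m \<Longrightarrow> f j < N"
  shows "minor (row_cons (x + A\<^sup>T *\<^sub>v y) A) f = minor (row_cons x A) f"
proof -
  \<comment> \<open>The unitriangular matrix of the row operation that adds the combination
    \<open>y\<close> of the rows of \<open>A\<close> to the first row.\<close>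
  define L where "L = mat (Suc m) (Suc m) (\<lambda>(i, j). if i = 0 then (if j = 0 then 1 else y $ (j - 1)) else if i = j then 1 else (0 :: 'a))"
  have L: "L \<in> carrier_mat (Suc m) (Suc m)" by (simp add: L_def)
  have "det L = prod_list (diag_mat L)"
    by (rule det_upper_triangular[OF _ L]) (auto simp: L_def)
  also have "diag_mat L = map (\<lambda>_. 1) [0..<Suc m]" by (auto simp: diag_mat_def L_def simp del: upt_Suc)
  finally have det: "det L = 1" by (simp add: map_replicate_const del: upt_Suc)
  have "row_cons (x + A\<^sup>T *\<^sub>v y) A = L * row_cons x A"
  proof (rule eq_matI)
    fix i j assume ij: "i < dim_row (L * row_cons x A)" "j < dim_col (L * row_cons x A)"
    then have ij': "i < Suc m" "j < N" using A by (auto simp: L_def)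
    have "(L * row_cons x A) $$ (i, j) = (\<Sum>l<Suc m. L $$ (i, l) * row_cons x A $$ (l, j))"
      using ij' A L by (simp add: scalar_prod_def atLeast0LessThan)
    also have "\<dots> = L $$ (i, 0) * x $ j + (\<Sum>l<m. L $$ (i, Suc l) * A $$ (l, j))"
      unfolding sum.lessThan_Suc_shift using ij' A by (simp add: row_cons_def)
    also have "\<dots> = row_cons (x + A\<^sup>T *\<^sub>v y) A $$ (i, j)"
    proof (cases "i = 0")
      case True
      then show ?thesis using ij' A x y
        by (simp add: row_cons_def L_def scalar_prod_def atLeast0LessThan mult.commute)
    next
      case False
      have "(\<Sum>l<m. L $$ (i, Suc l) * A $$ (l, j)) = (\<Sum>l<m. if l = i - 1 then A $$ (l, j) else 0)"
        using False ij' by (intro sum.cong) (auto simp: L_def)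
      then show ?thesis using False ij' A by (simp add: row_cons_def L_def)
    qed
    finally show "row_cons (x + A\<^sup>T *\<^sub>v y) A $$ (i, j) = (L * row_cons x A) $$ (i, j)" by simp
  qed (use A L in auto)
  then show ?thesis using minor_mult[OF L, of "row_cons x A" N f] A f det by simp
qed

text \<open>As \<open>p\<close> is orthogonal to the rows of \<open>A\<close>, the product is block
  triangular with corner \<open>p \<bullet> q\<close>. A unit vector \<open>q\<close> then reads off
  a coordinate of \<open>p\<close>.\<close>

lemma det_row_cons_mult_transpose:
  fixes A :: "'a :: idom mat"
  assumes A: "A \<in> carrier_mat m N" and p: "p \<in> carrier_vec N" and q: "q \<in> carrier_vec N"
    and orth: "A *\<^sub>v p = 0\<^sub>v m"
  shows "det (row_cons p A * (row_cons q A)\<^sup>T) = (p \<bullet> q) * det (A * A\<^sup>T)"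
proof -
  have Ap: "row A i \<bullet> p = 0" if "i < m" for i
    using arg_cong[OF orth, of "\<lambda>v. v $ i"] that A by simp
  have row: "row (row_cons z A) i = (if i = 0 then z else row A (i - 1))"
    if "i < Suc m" "z \<in> carrier_vec N" for i z
    using that A by (auto simp: row_cons_def intro!: eq_vecI)
  have "row_cons p A * (row_cons q A)\<^sup>T = four_block_mat (mat 1 1 (\<lambda>_. p \<bullet> q)) (0\<^sub>m 1 m)
    (mat m 1 (\<lambda>(i, _). row A i \<bullet> q)) (A * A\<^sup>T)"
    by (rule eq_matI) (use A p q Ap in \<open>auto simp: row comm_scalar_prod[OF p]\<close>)
  then show ?thesis using A
    by (simp add: det_four_block_mat_upper_right_zero[of _ 1 _ m] det_single)
qed

lemma det_single_nonzero_in_row_0: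
  fixes M :: "'a :: comm_ring_1 mat"
  assumes M: "M \<in> carrier_mat (Suc m) (Suc m)" and zero: "\<And>j. 0 < j \<Longrightarrow> j \<le> m \<Longrightarrow> M $$ (0, j) = 0"
  shows "det M = M $$ (0, 0) * det (mat m m (\<lambda>(i, j). M $$ (Suc i, Suc j)))"
proof -
  have "det M = (\<Sum>j<Suc m. M $$ (0, j) * cofactor M 0 j)"
    by (rule laplace_expansion_row[OF M]) simp
  also have "\<dots> = M $$ (0, 0) * cofactor M 0 0"
    unfolding sum.lessThan_Suc_shift using zero by (auto intro!: sum.neutral)
  also have "mat_delete M 0 0 = mat m m (\<lambda>(i, j). M $$ (Suc i, Suc j))"
    using M by (auto simp: mat_delete_def)
  then have "cofactor M 0 0 = det (mat m m (\<lambda>(i, j). M $$ (Suc i, Suc j)))"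
    by (simp add: cofactor_def)
  finally show ?thesis .
qed

lemma det_single_nonzero_in_column:
  fixes M :: "'a :: comm_ring_1 mat"
  assumes M: "M \<in> carrier_mat (Suc m) (Suc m)" and q: "q \<le> m"
    and zero: "\<And>i. 0 < i \<Longrightarrow> i \<le> m \<Longrightarrow> M $$ (i, q) = 0"
  shows "det M = M $$ (0, q) * (-1) ^ q * det (mat m m (\<lambda>(i, j). M $$ (Suc i, if j < q then j else Suc j)))"
proof -
  have "det M = (\<Sum>i<Suc m. M $$ (i, q) * cofactor M i q)"
    by (rule laplace_expansion_column[OF M]) (use q in simp)
  also have "\<dots> = M $$ (0, q) * cofactor M 0 q"
    unfolding sum.lessThan_Suc_shift using zero by (auto intro!: sum.neutral)
  also have "mat_delete M 0 q = mat m m (\<lambda>(i, j). M $$ (Suc i, if j < q then j else Suc j))"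
    using M by (auto simp: mat_delete_def)
  then have "cofactor M 0 q = (-1) ^ q * det (mat m m (\<lambda>(i, j). M $$ (Suc i, if j < q then j else Suc j)))"
    by (simp add: cofactor_def)
  finally show ?thesis by (simp add: mult.assoc)
qed

text \<open>An increasing selection meets column 0 only in its first place, so the Laplace expansion
  brings no sign. A selection missing this column sees a zero row.\<close>

lemma minor_row_cons_unit:
  fixes A :: "'a :: comm_ring_1 mat"
  assumes A: "A \<in> carrier_mat m N" and f: "incr (Suc m) N f"
  shows "minor (row_cons (unit_vec N 0) A) f = (if f 0 = 0 then minor A (f \<circ> Suc) else 0)"
proof -
  let ?M = "mat (Suc m) (Suc m) (\<lambda>(i, j). row_cons (unit_vec N 0) A $$ (i, f j))"
  have pos: "f j \<noteq> 0" if "0 < j" "j \<le> m" for j using incr_mono[OF f, of 0 j] that by simp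
  have N: "f j < N" if "j \<le> m" for j using incr_less[OF f, of j] that by simp
  have "det ?M = ?M $$ (0, 0) * det (mat m m (\<lambda>(i, j). ?M $$ (Suc i, Suc j)))"
  proof (rule det_single_nonzero_in_row_0)
    show "?M $$ (0, j) = 0" if "0 < j" "j \<le> m" for j
      using pos[OF that] N[OF that(2)] that A by (simp add: row_cons_def)
  qed simp
  also have "mat m m (\<lambda>(i, j). ?M $$ (Suc i, Suc j)) = mat m m (\<lambda>(i, j). A $$ (i, (f \<circ> Suc) j))"
    by (rule eq_matI) (use A N in \<open>auto simp: row_cons_def\<close>)
  also have "?M $$ (0, 0) = (if f 0 = 0 then 1 else 0)"
    using A N[of 0] by (auto simp: row_cons_def)
  finally show ?thesis using A by (simp add: minor_def)
qed

text \<open>Up to a positive factor, \<open>p $ 0 * det (A * A\<^sup>T)\<close> is the Cauchy--Binet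
  sum for \<open>row_cons p A\<close> and \<open>A\<close> bordered by the first unit vector. Each
  term vanishes or is a minor of \<open>row_cons p A\<close> times a minor of \<open>A\<close>,
  hence of the sign of \<open>s * t\<close>. The bound \<open>Suc m \<le> N\<close> provides the
  selection of the first columns, whose term is nonzero.\<close>

lemma orientation_sign:
  assumes A: "A \<in> carrier_mat m N" and p: "p \<in> carrier_vec N" and "Suc m \<le> N"
    and orth: "A *\<^sub>v p = 0\<^sub>v m"
    and s: "pos_minors s A" and t: "pos_minors t (row_cons p A)"
  shows "s * t * p $ 0 > 0"
proof -
  let ?e = "unit_vec N 0 :: real vec"
  have sA: "s * minor A f > 0" if "incr m N f" for f using s that A by (simp add: pos_minors_def)
  have tA: "t * minor (row_cons p A) f > 0" if "incr (Suc m) N f" for f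
    using t that A by (simp add: pos_minors_def)
  have shift: "incr m N (f \<circ> Suc)" if "incr (Suc m) N f" for f
    by (rule incrI) (use incr_less[OF that] incr_mono[OF that] in auto)
  have prod: "s * t * (minor (row_cons p A) f * minor (row_cons ?e A) f) =
    (if f 0 = 0 then (t * minor (row_cons p A) f) * (s * minor A (f \<circ> Suc)) else 0)"
    if "incr (Suc m) N f" for f
    using minor_row_cons_unit[OF A that] by simp
  have "incr (Suc m) N (\<lambda>i. i)" "incr m N (\<lambda>i. i)" by (rule incrI; use assms(3) in simp)+
  note id = this
  have "s * t * det (row_cons p A * (row_cons ?e A)\<^sup>T) > 0"
  proof (rule Cauchy_Binet_pos)
    show "s * t * (minor (row_cons p A) f * minor (row_cons ?e A) f) \<ge> 0" if "incr (Suc m) N f" for f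
      unfolding prod[OF that] using tA[OF that] sA[OF shift[OF that]] by (simp add: less_imp_le)
    show "s * t * (minor (row_cons p A) (\<lambda>i. i) * minor (row_cons ?e A) (\<lambda>i. i)) > 0"
      unfolding prod[OF id(1)] using tA[OF id(1)] sA[OF shift[OF id(1)]] by simp
  qed (use A id in auto)
  then have "s * t * (p $ 0) * det (A * A\<^sup>T) > 0"
    using det_row_cons_mult_transpose[OF A p _ orth, of ?e] p assms(3) by (simp add: mult.assoc)
  moreover have "1 * det (A * A\<^sup>T) > 0"
    by (rule Cauchy_Binet_pos[OF A A, of _ "\<lambda>i. i"]) (use sA[OF id(2)] id(2) in \<open>auto simp: zero_less_mult_iff\<close>)
  ultimately show ?thesis by (simp add: zero_less_mult_iff)
qed

section \<open>Bordered matrices\<close>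

definition left_border :: "'a :: zero_neq_one vec \<Rightarrow> 'a mat \<Rightarrow> 'a mat"
  where "left_border x A = mat (Suc (dim_row A)) (Suc (dim_col A))
    (\<lambda>(i, j). if j = 0 then (if i = 0 then 1 else 0) else row_cons x A $$ (i, j - 1))"

text \<open>The corner entry \<open>(-1)\<^sup>m\<close> cancels the sign of the Laplace expansion along the last column.\<close>

definition right_border :: "'a :: comm_ring_1 vec \<Rightarrow> 'a mat \<Rightarrow> 'a mat"
  where "right_border x A = mat (Suc (dim_row A)) (Suc (dim_col A))
    (\<lambda>(i, j). if j = dim_col A then (if i = 0 then (-1) ^ dim_row A else 0) else row_cons x A $$ (i, j))"

lemma left_border_carrier[simp]: "left_border x A \<in> carrier_mat (Suc m) (Suc N) \<longleftrightarrow> A \<in> carrier_mat m N"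
  unfolding left_border_def carrier_mat_def by simp

lemma right_border_carrier[simp]: "right_border x A \<in> carrier_mat (Suc m) (Suc N) \<longleftrightarrow> A \<in> carrier_mat m N"
  unfolding right_border_def carrier_mat_def by simp

lemma pos_minors_iff:
  assumes "A \<in> carrier_mat m N"
  shows "pos_minors s A \<longleftrightarrow> (\<forall>f. incr m N f \<longrightarrow> s * minor A f > 0)"
  using assms by (simp add: pos_minors_def)

lemma minor_left_border:
  assumes A: "A \<in> carrier_mat m N" and f: "incr (Suc m) (Suc N) f" "f 0 = 0"
  shows "minor (left_border x A) f = minor A (\<lambda>j. f (Suc j) - 1)"
proof -
  let ?T = "left_border x A"
  let ?M = "mat (Suc m) (Suc m) (\<lambda>(i, j). ?T $$ (i, f j))"
  have pos: "f (Suc j) > 0" "f (Suc j) < Suc N" if "j < m" for j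
    using incr_mono[OF f(1), of 0 "Suc j"] incr_less[OF f(1)] that by auto
  have "det ?M = ?M $$ (0, 0) * (-1) ^ 0 * det (mat m m (\<lambda>(i, j). ?M $$ (Suc i, if j < 0 then j else Suc j)))"
    by (rule det_single_nonzero_in_column) (use A f in \<open>auto simp: left_border_def\<close>)
  also have "mat m m (\<lambda>(i, j). ?M $$ (Suc i, if j < 0 then j else Suc j)) =
    mat m m (\<lambda>(i, j). A $$ (i, f (Suc j) - 1))"
    by (rule eq_matI) (use A pos in \<open>auto simp: left_border_def row_cons_def\<close>, fastforce+)
  also have "?M $$ (0, 0) = 1" using A f by (simp add: left_border_def)
  finally show ?thesis using A by (simp add: minor_def left_border_def)
qed

lemma incr_prepend:
  assumes "incr m N f"
  shows "incr (Suc m) (Suc N) (\<lambda>j. if j = 0 then 0 else Suc (f (j - 1)))"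
  by (rule incrI) (use incr_less[OF assms] incr_mono[OF assms] in auto)

lemma incr_append:
  assumes "incr m N f"
  shows "incr (Suc m) (Suc N) (\<lambda>j. if j < m then f j else N)"
  by (rule incrI) (use incr_less[OF assms] incr_mono[OF assms] in \<open>auto simp: less_Suc_eq\<close>)

text \<open>Selections through the border column expand along it to minors of \<open>A\<close>,
  without sign because the corner is at \<open>(0, 0)\<close>. The others are minors of
  \<open>row_cons x A\<close> with indices shifted by one. A single \<open>s\<close> thus governs
  both families.\<close>

lemma pos_minors_left_border:
  assumes A: "A \<in> carrier_mat m N"
  shows "pos_minors s (left_border x A) \<longleftrightarrow> pos_minors s A \<and> pos_minors s (row_cons x A)"
proof -
  let ?T = "left_border x A"
  note minor0 = minor_left_border[OF A, where x = x]
  have minor1: "minor ?T f = minor (row_cons x A) (\<lambda>j. f j - 1)" if f: "incr (Suc m) (Suc N) f" "f 0 > 0" for f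
  proof -
    have fj: "f j \<noteq> 0" "f j < Suc N" if "j < Suc m" for j
      using incr_mono[OF f(1), of 0 j] f(2) incr_less[OF f(1) that] that by (cases "j = 0", auto)+
    have "?T $$ (i, f j) = row_cons x A $$ (i, f j - 1)" if "i < Suc m" "j < Suc m" for i j
      using A fj[OF that(2)] that by (simp add: left_border_def)
    then show ?thesis using A unfolding minor_def
      by (intro arg_cong[where f = det] eq_matI) (auto simp: left_border_def)
  qed
  show ?thesis
    unfolding pos_minors_iff[OF A] pos_minors_iff[OF left_border_carrier[THEN iffD2, OF A]]
      pos_minors_iff[OF row_cons_carrier[THEN iffD2, OF A]]
  proof (intro iffI conjI allI impI)
    fix f assume *: "\<forall>f. incr (Suc m) (Suc N) f \<longrightarrow> s * minor ?T f > 0"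
    show "s * minor A f > 0" if f: "incr m N f"
    proof -
      let ?g = "\<lambda>j. if j = 0 then 0 else Suc (f (j - 1))"
      have "incr (Suc m) (Suc N) ?g" by (rule incr_prepend[OF f])
      with * minor0[of ?g] show ?thesis by force
    qed
    show "s * minor (row_cons x A) f > 0" if f: "incr (Suc m) N f"
    proof -
      let ?g = "\<lambda>j. Suc (f j)"
      have "incr (Suc m) (Suc N) ?g"
        by (rule incrI) (use incr_less[OF f] incr_mono[OF f] in auto)
      with * minor1[of ?g] show ?thesis by force
    qed
  next
    fix f assume *: "(\<forall>f. incr m N f \<longrightarrow> s * minor A f > 0) \<and> (\<forall>f. incr (Suc m) N f \<longrightarrow> s * minor (row_cons x A) f > 0)"
      and f: "incr (Suc m) (Suc N) f"
    show "s * minor ?T f > 0"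
    proof (cases "f 0 = 0")
      case True
      have "f (Suc i) - 1 < N" if "i < m" for i
        using incr_less[OF f, of "Suc i"] incr_mono[OF f, of 0 "Suc i"] that by simp
      moreover have "f (Suc i) - 1 < f (Suc j) - 1" if "i < j" "j < m" for i j
        using incr_mono[OF f, of "Suc i" "Suc j"] incr_mono[OF f, of 0 "Suc i"] that by simp
      ultimately have "incr m N (\<lambda>j. f (Suc j) - 1)" by (rule incrI)
      then show ?thesis using * minor0[OF f True] by simp
    next
      case False
      have pos: "f i > 0" if "i < Suc m" for i
        using False incr_mono[OF f, of 0 i] that by (cases "i = 0") auto
      have "f i - 1 < N" if "i < Suc m" for i
        using incr_less[OF f that] pos[OF that] by simp
      moreover have "f i - 1 < f j - 1" if "i < j" "j < Suc m" for i j
        using incr_mono[OF f that] pos[of i] that by simp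
      ultimately have "incr (Suc m) N (\<lambda>j. f j - 1)" by (rule incrI)
      then show ?thesis using * minor1[OF f] False by simp
    qed
  qed
qed

lemma minor_right_border:
  assumes A: "A \<in> carrier_mat m N" and f: "incr (Suc m) (Suc N) f" "f m = N"
  shows "minor (right_border x A) f = minor A f"
proof -
  let ?T = "right_border x A"
  let ?M = "mat (Suc m) (Suc m) (\<lambda>(i, j). ?T $$ (i, f j))"
  have less: "f j < N" "f j < Suc N" "f j \<noteq> N" if "j < m" for j using incr_mono[OF f(1) that] f(2) by auto
  have "det ?M = ?M $$ (0, m) * (-1) ^ m * det (mat m m (\<lambda>(i, j). ?M $$ (Suc i, if j < m then j else Suc j)))"
    by (rule det_single_nonzero_in_column) (use A f in \<open>auto simp: right_border_def\<close>)
  also have "mat m m (\<lambda>(i, j). ?M $$ (Suc i, if j < m then j else Suc j)) = mat m m (\<lambda>(i, j). A $$ (i, f j))"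
    by (rule eq_matI) (use A less in \<open>auto simp: right_border_def row_cons_def\<close>)
  also have "?M $$ (0, m) = (-1) ^ m" using A f by (simp add: right_border_def)
  finally show ?thesis using A by (simp add: minor_def right_border_def flip: power_mult_distrib)
qed

text \<open>A selection through the border column has it in last place, where the corner entry
  offsets the Laplace sign. The remaining selections need no shift.\<close>

lemma pos_minors_right_border:
  assumes A: "A \<in> carrier_mat m N"
  shows "pos_minors s (right_border x A) \<longleftrightarrow> pos_minors s A \<and> pos_minors s (row_cons x A)"
proof -
  let ?T = "right_border x A"
  note minor0 = minor_right_border[OF A, where x = x]
  have minor1: "minor ?T f = minor (row_cons x A) f" if f: "incr (Suc m) N f" for f
  proof -
    have "?T $$ (i, f j) = row_cons x A $$ (i, f j)" if "i < Suc m" "j < Suc m" for i j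
      using A incr_less[OF f that(2)] that by (simp add: right_border_def)
    then show ?thesis using A unfolding minor_def
      by (intro arg_cong[where f = det] eq_matI) (auto simp: right_border_def)
  qed
  have emb: "incr (Suc m) (Suc N) f" if "incr (Suc m) N f" for f
    by (rule incrI) (use incr_less[OF that] incr_mono[OF that] in \<open>auto simp: less_Suc_eq\<close>)
  show ?thesis
    unfolding pos_minors_iff[OF A] pos_minors_iff[OF right_border_carrier[THEN iffD2, OF A]]
      pos_minors_iff[OF row_cons_carrier[THEN iffD2, OF A]]
  proof (intro iffI conjI allI impI)
    fix f assume *: "\<forall>f. incr (Suc m) (Suc N) f \<longrightarrow> s * minor ?T f > 0"
    show "s * minor A f > 0" if f: "incr m N f"
    proof -
      let ?g = "\<lambda>j. if j < m then f j else N"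
      have g: "incr (Suc m) (Suc N) ?g" by (rule incr_append[OF f])
      have "minor A ?g = minor A f" by (rule minor_cong) (use A in auto)
      with * g minor0[OF g] show ?thesis by force
    qed
    show "s * minor (row_cons x A) f > 0" if f: "incr (Suc m) N f"
      using * emb[OF f] minor1[OF f] by force
  next
    fix f assume *: "(\<forall>f. incr m N f \<longrightarrow> s * minor A f > 0) \<and> (\<forall>f. incr (Suc m) N f \<longrightarrow> s * minor (row_cons x A) f > 0)"
      and f: "incr (Suc m) (Suc N) f"
    show "s * minor ?T f > 0"
    proof (cases "f m = N")
      case True
      have "incr m N f" by (rule incrI) (use incr_mono[OF f, of _ m] incr_mono[OF f] True in auto)
      then show ?thesis using * minor0[OF f True] by simp
    next
      case False
      then have fm: "f m < N" using incr_less[OF f, of m] by simp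
      have "f i < N" if "i < Suc m" for i
        using incr_mono[OF f, of i m] fm that by (cases "i = m") auto
      then have "incr (Suc m) N f" using incr_mono[OF f] by (intro incrI) auto
      then show ?thesis using * minor1 by simp
    qed
  qed
qed

text \<open>A nonzero minor of \<open>A\<close> extends through the border column to a nonzero minor
  of the bordered matrix.\<close>

lemma gram_det_left_border:
  fixes A :: "real mat"
  assumes A: "A \<in> carrier_mat m N" and rk: "det (A * A\<^sup>T) \<noteq> 0"
  shows "det (left_border x A * (left_border x A)\<^sup>T) \<noteq> 0"
proof -
  obtain f where f: "incr m N f" "minor A f \<noteq> 0" using rk gram_det_nonzero_iff_minor[OF A] by blast
  let ?g = "\<lambda>j. if j = 0 then 0 else Suc (f (j - 1))"
  have "minor (left_border x A) ?g = minor A f"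
    using minor_left_border[OF A incr_prepend[OF f(1)]] by simp
  then show ?thesis
    using f(2) incr_prepend[OF f(1)] gram_det_nonzero_iff_minor[of "left_border x A" "Suc m" "Suc N"] A by fastforce
qed

lemma gram_det_right_border:
  fixes A :: "real mat"
  assumes A: "A \<in> carrier_mat m N" and rk: "det (A * A\<^sup>T) \<noteq> 0"
  shows "det (right_border x A * (right_border x A)\<^sup>T) \<noteq> 0"
proof -
  obtain f where f: "incr m N f" "minor A f \<noteq> 0" using rk gram_det_nonzero_iff_minor[OF A] by blast
  let ?g = "\<lambda>j. if j < m then f j else N"
  have "minor (right_border x A) ?g = minor A ?g"
    using minor_right_border[OF A incr_append[OF f(1)]] by simp
  also have "\<dots> = minor A f" by (rule minor_cong) (use A in simp)
  finally show ?thesis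
    using f(2) incr_append[OF f(1)] gram_det_nonzero_iff_minor[of "right_border x A" "Suc m" "Suc N"] A by fastforce
qed


section \<open>Orthogonal complements and sign alternation\<close>

lemma perp_conv:
  "perp N W = {x \<in> carrier_vec N. \<forall>y \<in> W. x \<bullet> y = 0}"
  by (simp add: vec_module.orthogonal_complement_def)

lemma scalar_prod_row_space:
  fixes A :: "'a :: comm_ring_1 mat"
  assumes "A \<in> carrier_mat m N" "x \<in> carrier_vec N" "y \<in> carrier_vec m"
  shows "x \<bullet> (A\<^sup>T *\<^sub>v y) = y \<bullet> (A *\<^sub>v x)"
  using assms transpose_vec_mult_scalar[of A m N x y] by (simp add: comm_scalar_prod[of x N])

lemma perp_row_space:
  assumes A: "A \<in> carrier_mat m N"
  shows "perp N (vec_space.row_space N A) = {x \<in> carrier_vec N. A *\<^sub>v x = 0\<^sub>v m}"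
proof (intro equalityI subsetI)
  fix x assume "x \<in> perp N (vec_space.row_space N A)"
  then have x: "x \<in> carrier_vec N" "\<And>y. y \<in> vec_space.row_space N A \<Longrightarrow> x \<bullet> y = 0"
    by (auto simp: perp_conv)
  have "row A i \<bullet> x = 0" if "i < m" for i
    using x(2)[OF row_in_row_space[OF A that]] A x(1) that by (simp add: comm_scalar_prod[of x N])
  then have "A *\<^sub>v x = 0\<^sub>v m" using A by (intro eq_vecI) auto
  with x(1) show "x \<in> {x \<in> carrier_vec N. A *\<^sub>v x = 0\<^sub>v m}" by simp
next
  fix x assume "x \<in> {x \<in> carrier_vec N. A *\<^sub>v x = 0\<^sub>v m}"
  then show "x \<in> perp N (vec_space.row_space N A)"
    unfolding perp_conv row_space_conv[OF A] by (auto simp: scalar_prod_row_space[OF A])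
qed

lemma mat_inverse_obtain:
  fixes M :: "'a :: field mat"
  assumes M: "M \<in> carrier_mat n n" and "det M \<noteq> 0"
  obtains H where "H \<in> carrier_mat n n" "M * H = 1\<^sub>m n" "H * M = 1\<^sub>m n"
  using det_non_zero_imp_unit[OF assms, of "()"] by (auto simp: Units_def ring_mat_def)

text \<open>The coefficients \<open>y\<close> solve the normal equations, whose matrix
  \<open>A * A\<^sup>T\<close> is invertible.\<close>

lemma orthogonal_decomposition:
  fixes A :: "real mat"
  assumes A: "A \<in> carrier_mat m N" and rk: "det (A * A\<^sup>T) \<noteq> 0" and x: "x \<in> carrier_vec N"
  obtains p y where "p \<in> carrier_vec N" "A *\<^sub>v p = 0\<^sub>v m" "y \<in> carrier_vec m" "x = p + A\<^sup>T *\<^sub>v y"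
proof -
  obtain H where H: "H \<in> carrier_mat m m" "(A * A\<^sup>T) * H = 1\<^sub>m m"
    using mat_inverse_obtain[of "A * A\<^sup>T" m] rk A by auto
  define y where "y = H *\<^sub>v (A *\<^sub>v x)"
  have y: "y \<in> carrier_vec m" using H A x by (simp add: y_def)
  define p where "p = x - A\<^sup>T *\<^sub>v y"
  have p: "p \<in> carrier_vec N" using x A y by (simp add: p_def)
  have "A *\<^sub>v (A\<^sup>T *\<^sub>v y) = (A * A\<^sup>T) *\<^sub>v y"
    using A y by (simp add: assoc_mult_mat_vec[of _ m N])
  also have "\<dots> = ((A * A\<^sup>T) * H) *\<^sub>v (A *\<^sub>v x)"
    unfolding y_def by (rule assoc_mult_mat_vec[symmetric, of _ m m _ m]) (use A H(1) x in auto)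
  also have "\<dots> = A *\<^sub>v x" using H(2) A x by simp
  finally have "A *\<^sub>v p = 0\<^sub>v m"
    using A x y by (simp add: p_def mult_minus_distrib_mat_vec[of _ m N])
  moreover have "x = p + A\<^sup>T *\<^sub>v y" using x A y by (auto simp: p_def intro!: eq_vecI)
  ultimately show ?thesis using that p y by blast
qed

text \<open>The description in \<open>orth_proj\<close> has only one solution: the difference of two
  candidates lies in \<open>perp N W\<close> and is orthogonal to all of it, hence to
  itself.\<close>

lemma orth_proj_perp:
  assumes W: "W \<subseteq> carrier_vec N" and p: "p \<in> perp N W" and w: "w \<in> W"
  shows "orth_proj (perp N W) (p + w) = p"
  unfolding orth_proj_def
proof (rule the_equality)
  have pc: "p \<in> carrier_vec N" "w \<in> carrier_vec N" using p w W by (auto simp: perp_conv)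
  have "p + w - p = w" using pc by (auto intro!: eq_vecI)
  then show "p \<in> perp N W \<and> (\<forall>v\<in>perp N W. (p + w - p) \<bullet> v = 0)"
    using p w W by (auto simp: perp_conv comm_scalar_prod[of w N])
  fix q assume q: "q \<in> perp N W \<and> (\<forall>v\<in>perp N W. (p + w - q) \<bullet> v = 0)"
  then have qc: "q \<in> carrier_vec N" by (simp add: perp_conv)
  have d: "p - q \<in> perp N W"
    using p q W by (auto simp: perp_conv minus_scalar_prod_distrib[of _ N])
  have "p + w - q = (p - q) + w" using pc qc by (auto intro!: eq_vecI)
  then have "((p - q) + w) \<bullet> (p - q) = 0" using q d by metis
  moreover have "w \<bullet> (p - q) = 0" using d w pc qc by (auto simp: perp_conv comm_scalar_prod[of w N])
  ultimately have "(p - q) \<bullet> (p - q) = 0"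
    using pc qc by (simp add: add_scalar_prod_distrib[of _ N])
  then have "p - q = 0\<^sub>v N" using pc qc by (intro scalar_prod_self_eq_0) auto
  then show "q = p" using pc qc
    by (intro eq_vecI) (auto dest!: arg_cong[of _ _ "\<lambda>v. v $ _"] simp: vec_eq_iff)
qed

text \<open>For the harder inclusion, split off from \<open>x\<close> its part in the row space of
  \<open>B\<close>. The remainder is annihilated by \<open>A\<close> and \<open>B\<close>, hence by
  their invertible stack.\<close>

lemma perp_row_space_complement:
  fixes A B :: "real mat"
  assumes A: "A \<in> carrier_mat m N" and B: "B \<in> carrier_mat r N" and N: "N = m + r"
    and orth: "A * B\<^sup>T = 0\<^sub>m m r" and rkA: "det (A * A\<^sup>T) \<noteq> 0" and rkB: "det (B * B\<^sup>T) \<noteq> 0"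
  shows "perp N (vec_space.row_space N A) = vec_space.row_space N B"
proof (intro equalityI subsetI)
  fix x assume "x \<in> perp N (vec_space.row_space N A)"
  then have x: "x \<in> carrier_vec N" "A *\<^sub>v x = 0\<^sub>v m" by (auto simp: perp_row_space[OF A])
  obtain p y where p: "p \<in> carrier_vec N" "B *\<^sub>v p = 0\<^sub>v r" and y: "y \<in> carrier_vec r" "x = p + B\<^sup>T *\<^sub>v y"
    using orthogonal_decomposition[OF B rkB x(1)] by blast
  have "A *\<^sub>v (B\<^sup>T *\<^sub>v y) = (A * B\<^sup>T) *\<^sub>v y" using A B y by simp
  also have "\<dots> = 0\<^sub>v m" unfolding orth using y by (auto intro!: eq_vecI)
  finally have "A *\<^sub>v x = A *\<^sub>v p" using A B p y
    by (simp add: mult_add_distrib_mat_vec[of _ m N])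
  then have Ap: "A *\<^sub>v p = 0\<^sub>v m" using x by simp
  have AB: "A @\<^sub>r B \<in> carrier_mat N N" using A B N by auto
  have "det (A @\<^sub>r B) \<noteq> 0"
    using det_append_rows_orthogonal[of A m r B] A B N orth rkA rkB by auto
  moreover have "(A @\<^sub>r B) *\<^sub>v p = 0\<^sub>v m @\<^sub>v 0\<^sub>v r"
    using mat_mult_append[OF A B p(1)] Ap p(2) by simp
  then have "(A @\<^sub>r B) *\<^sub>v p = 0\<^sub>v N" using N by (auto intro!: eq_vecI)
  ultimately have "p = 0\<^sub>v N" using det_0_iff_vec_prod_zero[OF AB] p(1) by auto
  then have "x = B\<^sup>T *\<^sub>v y" using y B by simp
  then show "x \<in> vec_space.row_space N B" using y unfolding row_space_conv[OF B] by auto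
next
  fix x assume "x \<in> vec_space.row_space N B"
  then obtain y where y: "y \<in> carrier_vec r" "x = B\<^sup>T *\<^sub>v y" unfolding row_space_conv[OF B] by auto
  have "A *\<^sub>v x = (A * B\<^sup>T) *\<^sub>v y" using A B y by simp
  also have "\<dots> = 0\<^sub>v m" unfolding orth using y by (auto intro!: eq_vecI)
  finally show "x \<in> perp N (vec_space.row_space N A)" using y B by (simp add: perp_row_space[OF A])
qed

text \<open>Unit rows outside the columns of a nonzero minor complete \<open>A\<close> to an
  invertible matrix. Making them orthogonal to the rows of \<open>A\<close> takes only row
  operations, so the stack stays invertible.\<close>

lemma complement_matrix_exists:
  fixes A :: "real mat"
  assumes A: "A \<in> carrier_mat m (m + r)" and rk: "det (A * A\<^sup>T) \<noteq> 0"
  obtains B where "B \<in> carrier_mat r (m + r)" "A * B\<^sup>T = 0\<^sub>m m r" "det (B * B\<^sup>T) \<noteq> 0"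
proof -
  let ?N = "m + r"
  obtain f where f: "incr m ?N f" "minor A f \<noteq> 0" using rk gram_det_nonzero_iff_minor[OF A] by blast
  obtain g where g: "incr r ?N g" "f ` {..<m} \<inter> g ` {..<r} = {}" using complementary_incr[OF f(1)] by blast
  define E :: "real mat" where "E = unit_rows r ?N g"
  have E: "E \<in> carrier_mat r ?N" by (simp add: E_def unit_rows_def)
  have AE: "A @\<^sub>r E \<in> carrier_mat ?N ?N" using A E by auto
  have detAE: "det (A @\<^sub>r E) \<noteq> 0"
    using det_append_unit_rows[OF A f(1) g] f(2) by (simp add: E_def)
  obtain H where H: "H \<in> carrier_mat m m" "H * (A * A\<^sup>T) = 1\<^sub>m m"
    using mat_inverse_obtain[of "A * A\<^sup>T" m] rk A by auto
  \<comment> \<open>With this \<open>K\<close>, the rows of \<open>K * A + E\<close> are the unit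
    rows minus their orthogonal projections to the row space of \<open>A\<close>.\<close>
  define K where "K = - (E * A\<^sup>T * H)"
  have K: "K \<in> carrier_mat r m" using E A H by (simp add: K_def)
  define B where "B = K * A + E"
  have B: "B \<in> carrier_mat r ?N" using K A E by (simp add: B_def)
  have "K * (A * A\<^sup>T) = - (E * A\<^sup>T * H * (A * A\<^sup>T))"
    unfolding K_def by (rule uminus_mult_left_mat) (use E A H(1) in simp)
  also have "E * A\<^sup>T * H * (A * A\<^sup>T) = E * A\<^sup>T * (H * (A * A\<^sup>T))"
    by (rule assoc_mult_mat[of _ r m _ m _ m]) (use E A H(1) in auto)
  also have "\<dots> = E * A\<^sup>T" using E A by (simp add: H(2))
  finally have KA: "K * (A * A\<^sup>T) = - (E * A\<^sup>T)" .
  have "B * A\<^sup>T = K * (A * A\<^sup>T) + E * A\<^sup>T"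
    using K A E by (simp add: B_def add_mult_distrib_mat[of _ r ?N] assoc_mult_mat[of _ r m _ ?N])
  also have "\<dots> = 0\<^sub>m r m" unfolding KA using E A by (auto intro!: eq_matI)
  finally have BA: "B * A\<^sup>T = 0\<^sub>m r m" .
  have "A * B\<^sup>T = (B * A\<^sup>T)\<^sup>T" using A B by (simp add: transpose_mult[of _ r ?N])
  then have orth: "A * B\<^sup>T = 0\<^sub>m m r" unfolding BA by simp
  have "four_block_mat (1\<^sub>m m) (0\<^sub>m m r) K (1\<^sub>m r) * (A @\<^sub>r E) = A @\<^sub>r B"
    unfolding append_rows_def using A E K B
    by (subst mult_four_block_mat[where ?nr1.0 = m and ?nr2.0 = r]) (auto simp: B_def)
  moreover have "det (four_block_mat (1\<^sub>m m) (0\<^sub>m m r) K (1\<^sub>m r)) = 1"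
    using K by (subst det_four_block_mat_upper_right_zero[of _ m _ r]) auto
  ultimately have "det (A @\<^sub>r B) = det (A @\<^sub>r E)"
    using det_mult[of "four_block_mat (1\<^sub>m m) (0\<^sub>m m r) K (1\<^sub>m r)" ?N "A @\<^sub>r E"] AE K by auto
  then have "det (B * B\<^sup>T) \<noteq> 0" using det_append_rows_orthogonal[OF A B orth] detAE by auto
  with that B orth show ?thesis by blast
qed

section \<open>The sign alternation on vectors, subspaces and matrices\<close>

lemma dim_alt[simp]: "dim_vec (alt v) = dim_vec v"
  by (simp add: alt_def)

lemma alt_carrier[simp]: "alt v \<in> carrier_vec N \<longleftrightarrow> v \<in> carrier_vec N"
  unfolding carrier_vec_def by simp

lemma alt_index[simp]: "i < dim_vec v \<Longrightarrow> alt v $ i = (-1) ^ i * v $ i"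
  by (simp add: alt_def)

lemma alt_alt[simp]: "alt (alt v) = v"
  by (rule eq_vecI) auto

lemma alt_add: "v \<in> carrier_vec N \<Longrightarrow> w \<in> carrier_vec N \<Longrightarrow> alt (v + w) = alt v + alt w"
  by (rule eq_vecI) (auto simp: algebra_simps)

lemma alt_scalar_prod: "alt v \<bullet> w = v \<bullet> alt w" if "dim_vec v = dim_vec w"
  using that by (auto simp: scalar_prod_def intro!: sum.cong)

text \<open>The map \<open>alt\<close> is a self-adjoint involution for the scalar product.\<close>

lemma perp_alt:
  assumes "W \<subseteq> carrier_vec N"
  shows "perp N (alt ` W) = alt ` perp N W"
proof (intro equalityI subsetI)
  fix x assume "x \<in> perp N (alt ` W)"
  then have "alt x \<in> perp N W" using assms by (auto simp: perp_conv alt_scalar_prod)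
  then show "x \<in> alt ` perp N W" by (metis alt_alt imageI)
next
  fix x assume "x \<in> alt ` perp N W"
  then show "x \<in> perp N (alt ` W)" using assms by (auto simp: perp_conv alt_scalar_prod)
qed

lemma alt_mat_alt_mat[simp]: "alt_mat (alt_mat A) = A"
  by (rule eq_matI) (auto simp: alt_mat_def)

lemma row_space_alt_mat:
  fixes B :: "real mat"
  assumes B: "B \<in> carrier_mat m N"
  shows "vec_space.row_space N (alt_mat B) = alt ` vec_space.row_space N B"
proof -
  have "(alt_mat B)\<^sup>T *\<^sub>v y = alt (B\<^sup>T *\<^sub>v y)" if "y \<in> carrier_vec m" for y
    by (rule eq_vecI) (use B that in \<open>auto simp: alt_mat_def scalar_prod_def sum_distrib_left mult.assoc\<close>)
  then show ?thesis using B by (auto simp: row_space_conv[of _ m] image_image)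
qed

lemma gram_alt_mat: "alt_mat A * (alt_mat A)\<^sup>T = A * A\<^sup>T"
proof (rule eq_matI)
  have "(-1) ^ l * a * ((-1) ^ l * b) = a * b" for l :: nat and a b :: 'a
    by (simp add: mult.assoc mult.left_commute[of a])
  then show "(alt_mat A * (alt_mat A)\<^sup>T) $$ (i, j) = (A * A\<^sup>T) $$ (i, j)"
    if "i < dim_row (A * A\<^sup>T)" "j < dim_col (A * A\<^sup>T)" for i j
    using that by (auto simp: alt_mat_def scalar_prod_def intro!: sum.cong)
qed (auto simp: alt_mat_def)


section \<open>Graphs of functionals and the duality\<close>

lemma row_space_mono:
  fixes A B :: "'a :: field mat"
  assumes A: "A \<in> carrier_mat m N" and "set (rows A) \<subseteq> S" "S \<subseteq> carrier_vec N"
  shows "vec_space.row_space N A \<subseteq> LinearCombinations.module.span class_ring (module_vec TYPE('a) N) S"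
proof -
  interpret vec_space "TYPE('a)" N .
  show ?thesis unfolding row_space_def using assms(2) by (rule span_is_monotone)
qed

lemma a_rcosets_conv:
  "\<eta> \<in> a_rcosets\<^bsub>Rn N\<^esub> W \<longleftrightarrow> (\<exists>e \<in> carrier_vec N. \<eta> = (\<lambda>w. w + e) ` W)"
  by (auto simp: A_RCOSETS_def' a_r_coset_def' module_vec_simps)

lemma row_cons_transpose_mult:
  fixes A :: "'a :: comm_ring_1 mat"
  assumes A: "A \<in> carrier_mat m N" and e: "e \<in> carrier_vec N" and y: "y \<in> carrier_vec m"
  shows "(row_cons e A)\<^sup>T *\<^sub>v vCons c y = c \<cdot>\<^sub>v e + A\<^sup>T *\<^sub>v y"
proof (rule eq_vecI)
  fix i assume "i < dim_vec (c \<cdot>\<^sub>v e + A\<^sup>T *\<^sub>v y)"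
  then have i: "i < N" using A by simp
  have "col (row_cons e A) i = vCons (e $ i) (col A i)"
    by (rule eq_vecI) (use A i in \<open>auto simp: row_cons_def vCons_def split: nat.split\<close>)
  then show "((row_cons e A)\<^sup>T *\<^sub>v vCons c y) $ i = (c \<cdot>\<^sub>v e + A\<^sup>T *\<^sub>v y) $ i"
    using A e i by (simp add: mult.commute)
qed (use A in auto)

text \<open>Representatives differ by elements of the row space, so adjoining the whole coset adds
  only the direction of \<open>e\<close>.\<close>

lemma extend_row_space:
  assumes A: "A \<in> carrier_mat m N" and e: "e \<in> carrier_vec N"
  shows "extend N (vec_space.row_space N A) ((\<lambda>v. v + e) ` vec_space.row_space N A) =
    vec_space.row_space N (row_cons e A)"
proof -
  interpret vec_space "TYPE(real)" N .
  let ?S = "row_space A \<union> (\<lambda>v. v + e) ` row_space A"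
  have E: "row_cons e A \<in> carrier_mat (Suc m) N" using A by simp
  have rs: "row_space A \<subseteq> carrier_vec N" using A by (auto simp: row_space_conv[OF A])
  have rowsE: "set (rows (row_cons e A)) \<subseteq> carrier_vec N" using A rows_carrier[of "row_cons e A"] by simp
  have zero: "0\<^sub>v N \<in> row_space A"
    unfolding row_space_conv[OF A] by (rule image_eqI[of _ _ "0\<^sub>v m"]) (use A in \<open>auto intro!: eq_vecI\<close>)
  have "set (rows (row_cons e A)) \<subseteq> ?S"
  proof
    fix x assume "x \<in> set (rows (row_cons e A))"
    then obtain i where i: "i < Suc m" "x = row (row_cons e A) i"
      using A by (auto simp: in_set_conv_nth)
    show "x \<in> ?S"
    proof (cases i)
      case 0
      then have "x = 0\<^sub>v N + e" using i A e by (auto simp: row_cons_def intro!: eq_vecI)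
      then show ?thesis using zero by blast
    next
      case (Suc i')
      then have "x = row A i'" using i A by (auto simp: row_cons_def intro!: eq_vecI)
      then show ?thesis using row_in_row_space[OF A, of i'] i Suc by simp
    qed
  qed
  moreover have S: "?S \<subseteq> carrier_vec N" using rs e by auto
  ultimately have "row_space (row_cons e A) \<subseteq> span ?S" by (rule row_space_mono[OF E])
  moreover have "span ?S \<subseteq> row_space (row_cons e A)"
    unfolding row_space_def[of "row_cons e A"]
  proof (rule span_subsetI[OF rowsE], fold row_space_def, rule subsetI)
    fix x assume "x \<in> ?S"
    then obtain y c where y: "y \<in> carrier_vec m" and x: "x = c \<cdot>\<^sub>v e + A\<^sup>T *\<^sub>v y"
    proof (elim UnE imageE, goal_cases)
      case 1
      then obtain y where y: "y \<in> carrier_vec m" "x = A\<^sup>T *\<^sub>v y" unfolding row_space_conv[OF A] by auto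
      then have "x = 0 \<cdot>\<^sub>v e + A\<^sup>T *\<^sub>v y" using e A by (auto intro!: eq_vecI)
      then show ?case using 1 y by blast
    next
      case (2 v)
      then obtain y where y: "y \<in> carrier_vec m" "v = A\<^sup>T *\<^sub>v y" unfolding row_space_conv[OF A] by auto
      then have "x = 1 \<cdot>\<^sub>v e + A\<^sup>T *\<^sub>v y" using e A 2 by (auto intro!: eq_vecI)
      then show ?case using 2 y by blast
    qed
    then have "x = (row_cons e A)\<^sup>T *\<^sub>v vCons c y" using row_cons_transpose_mult[OF A e y] by simp
    then show "x \<in> row_space (row_cons e A)" using y unfolding row_space_conv[OF E] by auto
  qed
  ultimately show ?thesis by (simp add: extend_def)
qed

lemma pairing_eq:
  assumes W: "W \<subseteq> carrier_vec N" and v: "v \<in> W" and x: "x \<in> carrier_vec N"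
  shows "pairing ((\<lambda>w. w + x) ` perp N W) v = x \<bullet> v"
proof -
  have "(w + x) \<bullet> v = x \<bullet> v" if "w \<in> perp N W" for w
    using that W v x by (auto simp: perp_conv add_scalar_prod_distrib[of _ N])
  \<comment> \<open>Zero in the complement makes the coset nonempty, so the constant sought by
    \<open>pairing\<close> is unique.\<close>
  moreover have "0\<^sub>v N \<in> perp N W" using W by (auto simp: perp_conv)
  ultimately show ?thesis
    unfolding pairing_def by (intro the_equality) auto
qed

definition left_graph :: "'a :: comm_ring_1 vec \<Rightarrow> 'a mat \<Rightarrow> 'a mat"
  where "left_graph x A = mat (dim_row A) (Suc (dim_col A))
    (\<lambda>(i, j). if j = 0 then row A i \<bullet> x else A $$ (i, j - 1))"

definition right_graph :: "'a :: comm_ring_1 vec \<Rightarrow> 'a mat \<Rightarrow> 'a mat"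
  where "right_graph x A = mat (dim_row A) (Suc (dim_col A))
    (\<lambda>(i, j). if j = dim_col A then row A i \<bullet> x else A $$ (i, j))"

lemma left_graph_carrier[simp]: "left_graph x A \<in> carrier_mat m (Suc N) \<longleftrightarrow> A \<in> carrier_mat m N"
  unfolding left_graph_def carrier_mat_def by simp

lemma right_graph_carrier[simp]: "right_graph x A \<in> carrier_mat m (Suc N) \<longleftrightarrow> A \<in> carrier_mat m N"
  unfolding right_graph_def carrier_mat_def by simp

lemma left_graph_transpose_mult:
  fixes A :: "'a :: comm_ring_1 mat"
  assumes A: "A \<in> carrier_mat m N" and x: "x \<in> carrier_vec N" and y: "y \<in> carrier_vec m"
  shows "(left_graph x A)\<^sup>T *\<^sub>v y = vCons (x \<bullet> (A\<^sup>T *\<^sub>v y)) (A\<^sup>T *\<^sub>v y)"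
proof (rule eq_vecI)
  fix i assume i: "i < dim_vec (vCons (x \<bullet> (A\<^sup>T *\<^sub>v y)) (A\<^sup>T *\<^sub>v y))"
  show "((left_graph x A)\<^sup>T *\<^sub>v y) $ i = vCons (x \<bullet> (A\<^sup>T *\<^sub>v y)) (A\<^sup>T *\<^sub>v y) $ i"
  proof (cases i)
    case 0
    have "col (left_graph x A) 0 = A *\<^sub>v x"
      by (rule eq_vecI) (use A in \<open>auto simp: left_graph_def\<close>)
    moreover have "(A *\<^sub>v x) \<bullet> y = x \<bullet> (A\<^sup>T *\<^sub>v y)"
      unfolding scalar_prod_row_space[OF A x y] by (rule comm_scalar_prod) (use A x y in auto)
    ultimately show ?thesis using 0 A by (simp add: left_graph_def)
  next
    case (Suc i')
    then have "col (left_graph x A) i = col A i'"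
      using i A by (intro eq_vecI) (auto simp: left_graph_def)
    then show ?thesis using Suc i A by (simp add: left_graph_def)
  qed
qed (use A in \<open>auto simp: left_graph_def\<close>)

lemma right_graph_transpose_mult:
  fixes A :: "'a :: comm_ring_1 mat"
  assumes A: "A \<in> carrier_mat m N" and x: "x \<in> carrier_vec N" and y: "y \<in> carrier_vec m"
  shows "(right_graph x A)\<^sup>T *\<^sub>v y = (A\<^sup>T *\<^sub>v y) @\<^sub>v vec_of_list [x \<bullet> (A\<^sup>T *\<^sub>v y)]"
proof (rule eq_vecI)
  fix i assume "i < dim_vec ((A\<^sup>T *\<^sub>v y) @\<^sub>v vec_of_list [x \<bullet> (A\<^sup>T *\<^sub>v y)])"
  then have i: "i < Suc N" using A by simp
  show "((right_graph x A)\<^sup>T *\<^sub>v y) $ i = ((A\<^sup>T *\<^sub>v y) @\<^sub>v vec_of_list [x \<bullet> (A\<^sup>T *\<^sub>v y)]) $ i"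
  proof (cases "i = N")
    case True
    have "col (right_graph x A) N = A *\<^sub>v x"
      by (rule eq_vecI) (use A in \<open>auto simp: right_graph_def\<close>)
    moreover have "(A *\<^sub>v x) \<bullet> y = x \<bullet> (A\<^sup>T *\<^sub>v y)"
      unfolding scalar_prod_row_space[OF A x y] by (rule comm_scalar_prod) (use A x y in auto)
    ultimately show ?thesis using True A by (simp add: right_graph_def)
  next
    case False
    then have "col (right_graph x A) i = col A i"
      using i A by (intro eq_vecI) (auto simp: right_graph_def)
    then show ?thesis using False i A by (simp add: right_graph_def)
  qed
qed (use A in \<open>auto simp: right_graph_def\<close>)

text \<open>For a graph matrix \<open>G\<close>, forgetting the extra coordinate leads back to
  \<open>A\<close>, so independence of the rows lifts to the graph.\<close>

lemma gram_det_graph: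
  fixes A G :: "real mat"
  assumes A: "A \<in> carrier_mat m N" and rk: "det (A * A\<^sup>T) \<noteq> 0" and G: "G \<in> carrier_mat m N'"
    and inj: "\<And>y. y \<in> carrier_vec m \<Longrightarrow> G\<^sup>T *\<^sub>v y = 0\<^sub>v N' \<Longrightarrow> A\<^sup>T *\<^sub>v y = 0\<^sub>v N"
  shows "det (G * G\<^sup>T) \<noteq> 0"
  using rk inj unfolding gram_det_nonzero_iff_inj[OF A] gram_det_nonzero_iff_inj[OF G] by blast

lemma gram_det_left_graph:
  fixes A :: "real mat"
  assumes A: "A \<in> carrier_mat m N" and rk: "det (A * A\<^sup>T) \<noteq> 0" and x: "x \<in> carrier_vec N"
  shows "det (left_graph x A * (left_graph x A)\<^sup>T) \<noteq> 0"
proof (rule gram_det_graph[OF A rk])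
  fix y :: "real vec" assume y: "y \<in> carrier_vec m" "(left_graph x A)\<^sup>T *\<^sub>v y = 0\<^sub>v (Suc N)"
  then have *: "vCons (x \<bullet> (A\<^sup>T *\<^sub>v y)) (A\<^sup>T *\<^sub>v y) $ Suc i = 0" if "i < N" for i
    using left_graph_transpose_mult[OF A x y(1)] that by simp
  then show "A\<^sup>T *\<^sub>v y = 0\<^sub>v N" using A by (intro eq_vecI) auto
qed (use A in simp)

lemma gram_det_right_graph:
  fixes A :: "real mat"
  assumes A: "A \<in> carrier_mat m N" and rk: "det (A * A\<^sup>T) \<noteq> 0" and x: "x \<in> carrier_vec N"
  shows "det (right_graph x A * (right_graph x A)\<^sup>T) \<noteq> 0"
proof (rule gram_det_graph[OF A rk])
  fix y :: "real vec" assume y: "y \<in> carrier_vec m" "(right_graph x A)\<^sup>T *\<^sub>v y = 0\<^sub>v (Suc N)"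
  then have "((A\<^sup>T *\<^sub>v y) @\<^sub>v vec_of_list [x \<bullet> (A\<^sup>T *\<^sub>v y)]) $ i = 0" if "i < N" for i
    using right_graph_transpose_mult[OF A x y(1)] that by simp
  then have "(A\<^sup>T *\<^sub>v y) $ i = 0" if "i < N" for i
    using that A by (metis index_append_vec(1) index_mult_mat_vec carrier_matD(2) dim_mult_mat_vec index_transpose_mat(2) trans_less_add1)
  then show "A\<^sup>T *\<^sub>v y = 0\<^sub>v N" using A by (intro eq_vecI) auto
qed (use A in simp)

lemma row_space_left_graph:
  fixes A :: "'a :: field mat"
  assumes A: "A \<in> carrier_mat m N" and x: "x \<in> carrier_vec N"
  shows "vec_space.row_space (Suc N) (left_graph x A) = (\<lambda>v. vCons (x \<bullet> v) v) ` vec_space.row_space N A"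
  unfolding row_space_conv[OF A] row_space_conv[OF left_graph_carrier[THEN iffD2, OF A]] image_image
  by (rule image_cong) (simp_all add: left_graph_transpose_mult[OF A x])

lemma row_space_right_graph:
  fixes A :: "'a :: field mat"
  assumes A: "A \<in> carrier_mat m N" and x: "x \<in> carrier_vec N"
  shows "vec_space.row_space (Suc N) (right_graph x A) =
    (\<lambda>v. v @\<^sub>v vec_of_list [x \<bullet> v]) ` vec_space.row_space N A"
  unfolding row_space_conv[OF A] row_space_conv[OF right_graph_carrier[THEN iffD2, OF A]] image_image
  by (rule image_cong) (simp_all add: right_graph_transpose_mult[OF A x])

lemma mult_transpose_zero_iff:
  fixes A B :: "'a :: comm_ring_1 mat"
  assumes "A \<in> carrier_mat m N" "B \<in> carrier_mat r N"
  shows "A * B\<^sup>T = 0\<^sub>m m r \<longleftrightarrow> (\<forall>i<m. \<forall>j<r. (\<Sum>l<N. A $$ (i, l) * B $$ (j, l)) = 0)"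
  using assms by (auto simp: mat_eq_iff scalar_prod_def atLeast0LessThan)

text \<open>The new coordinate in front moves index \<open>l\<close> to \<open>l + 1\<close>, so the
  second alternation turns \<open>alt_mat B\<close> into \<open>- B\<close>, while the new entry is
  the product of \<open>e\<close> with a row of \<open>B\<close>. Against the row
  \<open>(1, e)\<close> these contributions cancel; against the rows \<open>(0, A)\<close> the
  assumed orthogonality remains.\<close>

lemma left_border_left_graph_orthogonal:
  fixes A B :: "'a :: comm_ring_1 mat"
  assumes A: "A \<in> carrier_mat m N" and B: "B \<in> carrier_mat r N" and e: "e \<in> carrier_vec N"
    and orth: "A * B\<^sup>T = 0\<^sub>m m r"
  shows "left_border e A * (alt_mat (left_graph (vec N (\<lambda>l. (-1) ^ l * e $ l)) (alt_mat B)))\<^sup>T = 0\<^sub>m (Suc m) r"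
proof -
  let ?e = "vec N (\<lambda>l. (-1) ^ l * e $ l)"
  let ?L = "alt_mat (left_graph ?e (alt_mat B))"
  have AB: "(\<Sum>l<N. A $$ (i, l) * B $$ (j, l)) = 0" if "i < m" "j < r" for i j
    using orth that unfolding mult_transpose_zero_iff[OF A B] by blast
  have L0: "?L $$ (j, 0) = (\<Sum>l<N. e $ l * B $$ (j, l))" if "j < r" for j
    using that B by (auto simp: alt_mat_def left_graph_def scalar_prod_def atLeast0LessThan mult.assoc mult.left_commute[of "B $$ _"]
        mult.commute[of "B $$ _"] intro!: sum.cong)
  have LS: "?L $$ (j, Suc l) = - B $$ (j, l)" if "j < r" "l < N" for j l
    using that B by (simp add: alt_mat_def left_graph_def)
  have T: "left_border e A $$ (i, Suc l) = row_cons e A $$ (i, l)" if "i < Suc m" "l < N" for i l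
    using that A by (simp add: left_border_def)
  have "(\<Sum>l<Suc N. left_border e A $$ (i, l) * ?L $$ (j, l)) = 0" if "i < Suc m" "j < r" for i j
  proof -
    have "(\<Sum>l<Suc N. left_border e A $$ (i, l) * ?L $$ (j, l)) =
      left_border e A $$ (i, 0) * (\<Sum>l<N. e $ l * B $$ (j, l)) - (\<Sum>l<N. row_cons e A $$ (i, l) * B $$ (j, l))"
      unfolding sum.lessThan_Suc_shift using that L0 LS T by (simp add: sum_negf)
    also have "\<dots> = 0"
      using that A AB[of "i - 1" j] by (cases i) (simp_all add: left_border_def row_cons_def)
    finally show ?thesis .
  qed
  then show ?thesis using A B by (subst mult_transpose_zero_iff[of _ _ "Suc N"]) auto
qed

text \<open>In column \<open>N = m + r\<close> the alternation contributes
  \<open>(-1) ^ (m + r)\<close> and the corner \<open>(-1) ^ r\<close>, together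
  \<open>(-1) ^ m\<close>. This cancels the factor \<open>(-1) ^ m\<close> of the functional and
  leaves the product of a row of \<open>A\<close> with \<open>x\<close>, which the alternated border
  row \<open>- x\<close> compensates.\<close>

lemma right_graph_right_border_orthogonal:
  fixes A B :: "'a :: comm_ring_1 mat"
  assumes A: "A \<in> carrier_mat m N" and B: "B \<in> carrier_mat r N" and x: "x \<in> carrier_vec N" and N: "N = m + r"
    and orth: "A * B\<^sup>T = 0\<^sub>m m r"
  shows "right_graph ((-1) ^ m \<cdot>\<^sub>v x) A * (alt_mat (right_border (vec N (\<lambda>l. - ((-1) ^ l * x $ l))) (alt_mat B)))\<^sup>T = 0\<^sub>m m (Suc r)"
proof -
  let ?x = "vec N (\<lambda>l. - ((-1) ^ l * x $ l))"
  let ?T = "alt_mat (right_border ?x (alt_mat B))"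
  let ?R = "right_graph ((-1) ^ m \<cdot>\<^sub>v x) A"
  have AB: "(\<Sum>l<N. A $$ (i, l) * B $$ (j, l)) = 0" if "i < m" "j < r" for i j
    using orth that unfolding mult_transpose_zero_iff[OF A B] by blast
  have R: "?R $$ (i, l) = A $$ (i, l)" if "i < m" "l < N" for i l
    using that A by (simp add: right_graph_def)
  have RN: "?R $$ (i, N) = (-1) ^ m * (\<Sum>l<N. A $$ (i, l) * x $ l)" if "i < m" for i
    using that A x by (simp add: right_graph_def scalar_prod_def atLeast0LessThan sum_distrib_left mult.left_commute)
  have T: "?T $$ (j, l) = (if j = 0 then - x $ l else B $$ (j - 1, l))" if "j < Suc r" "l < N" for j l
    using that B by (auto simp: alt_mat_def right_border_def row_cons_def)
  have TN: "?T $$ (j, N) = (if j = 0 then (-1) ^ m else 0)" if "j < Suc r" for j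
    using that B by (auto simp: alt_mat_def right_border_def N power_add mult.assoc)
  have "(\<Sum>l<Suc N. ?R $$ (i, l) * ?T $$ (j, l)) = 0" if "i < m" "j < Suc r" for i j
  proof -
    have "(\<Sum>l<Suc N. ?R $$ (i, l) * ?T $$ (j, l)) =
      (\<Sum>l<N. A $$ (i, l) * (if j = 0 then - x $ l else B $$ (j - 1, l))) +
      (-1) ^ m * (\<Sum>l<N. A $$ (i, l) * x $ l) * (if j = 0 then (-1) ^ m else 0)"
      using that by (simp add: R RN T TN)
    also have "\<dots> = 0"
      using that AB[of i "j - 1"] by (cases j) (simp_all add: sum_negf mult.commute[of "(-1) ^ m"] mult.assoc)
    finally show ?thesis .
  qed
  then show ?thesis using A B by (subst mult_transpose_zero_iff[of _ _ "Suc N"]) auto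
qed

section \<open>Coherence of signs, graphs and orientation\<close>

definition definite_minors :: "real mat \<Rightarrow> bool"
  where "definite_minors A \<longleftrightarrow> (\<exists>s. s \<noteq> 0 \<and> pos_minors s A)"

text \<open>A change of basis of \<open>A\<close> multiplies both families by the same determinant,
  so a common \<open>s\<close> is meaningful for the space. Replacing \<open>e\<close> by
  \<open>- e\<close> reverses only the second family.\<close>

definition coherent :: "real mat \<Rightarrow> real vec \<Rightarrow> bool"
  where "coherent A e \<longleftrightarrow> (\<exists>s. s \<noteq> 0 \<and> pos_minors s A \<and> pos_minors s (row_cons e A))"

lemma definite_minors_dual:
  assumes "A \<in> carrier_mat m N" "B \<in> carrier_mat r N" "N = m + r"
    and "A * B\<^sup>T = 0\<^sub>m m r" "det (A * A\<^sup>T) \<noteq> 0" "det (B * B\<^sup>T) \<noteq> 0"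
  shows "definite_minors A \<longleftrightarrow> definite_minors (alt_mat B)"
proof -
  obtain c where c: "c \<noteq> 0" "\<And>s. pos_minors s A \<longleftrightarrow> pos_minors (c * s) (alt_mat B)"
    using pos_minors_dual[OF assms] by blast
  have "pos_minors t (alt_mat B) \<longleftrightarrow> pos_minors (t / c) A" for t using c by simp
  then show ?thesis unfolding definite_minors_def using c
    by (metis divide_eq_0_iff mult_eq_0_iff)
qed

lemma pos_minors_scale: "c > 0 \<Longrightarrow> pos_minors s A \<Longrightarrow> pos_minors (c * s) A"
  by (simp add: pos_minors_def mult.assoc)

text \<open>Replacing \<open>e\<close> by its component \<open>p\<close> orthogonal to the rows of
  \<open>A\<close> changes no minor, and \<open>p\<close> is the projection of every representative.
  If the families are definite with factors \<open>s\<close> and \<open>t\<close>, then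
  \<open>s * t * p $ 0 > 0\<close>, so \<open>p $ 0\<close> is positive exactly when the factors
  have equal sign.\<close>

lemma coherent_iff:
  assumes A: "A \<in> carrier_mat m N" and mN: "Suc m \<le> N" and rk: "det (A * A\<^sup>T) \<noteq> 0"
    and e: "e \<in> carrier_vec N"
  shows "coherent A e \<longleftrightarrow> definite_minors A \<and> definite_minors (row_cons e A) \<and>
    positively_oriented N (vec_space.row_space N A) ((\<lambda>v. v + e) ` vec_space.row_space N A)"
proof -
  let ?V = "vec_space.row_space N A"
  obtain p y where p: "p \<in> carrier_vec N" "A *\<^sub>v p = 0\<^sub>v m" and y: "y \<in> carrier_vec m" and ep: "e = p + A\<^sup>T *\<^sub>v y"
    using orthogonal_decomposition[OF A rk e] by blast
  have V: "?V \<subseteq> carrier_vec N" using A by (auto simp: row_space_conv[OF A])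
  have "orth_proj (perp N ?V) (v + e) = p" if v: "v \<in> ?V" for v
  proof -
    obtain z where z: "z \<in> carrier_vec m" "v = A\<^sup>T *\<^sub>v z" using v unfolding row_space_conv[OF A] by auto
    have "v + e = p + A\<^sup>T *\<^sub>v (z + y)"
      using A y z p ep by (auto simp: mult_add_distrib_mat_vec[of _ N m] intro!: eq_vecI)
    moreover have "A\<^sup>T *\<^sub>v (z + y) \<in> ?V" using y z unfolding row_space_conv[OF A] by auto
    ultimately show ?thesis
      using orth_proj_perp[OF V, of p] p by (simp add: perp_row_space[OF A])
  qed
  moreover have "0\<^sub>v N \<in> ?V"
    unfolding row_space_conv[OF A] by (rule image_eqI[of _ _ "0\<^sub>v m"]) (use A in \<open>auto intro!: eq_vecI\<close>)
  ultimately have po: "positively_oriented N ?V ((\<lambda>v. v + e) ` ?V) \<longleftrightarrow> p $ 0 > 0"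
    unfolding positively_oriented_def by auto
  have minor: "minor (row_cons e A) f = minor (row_cons p A) f" if "incr (Suc m) N f" for f
    unfolding ep by (rule minor_row_cons_add[OF A p(1) y]) (rule incr_less[OF that])
  have pe: "pos_minors t (row_cons e A) \<longleftrightarrow> pos_minors t (row_cons p A)" for t
    using A minor by (simp add: pos_minors_def)
  have sign: "s * t * p $ 0 > 0" if "pos_minors s A" "pos_minors t (row_cons e A)" for s t
    using orientation_sign[OF A p(1) mN p(2)] that pe by blast
  show ?thesis
  proof
    assume "coherent A e"
    then obtain s where s: "s \<noteq> 0" "pos_minors s A" "pos_minors s (row_cons e A)"
      by (auto simp: coherent_def)
    moreover have "s * s > 0" using s(1) by (cases "s > 0") (auto simp: zero_less_mult_iff)
    then have "p $ 0 > 0" using sign[OF s(2,3)] by (simp add: zero_less_mult_iff)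
    ultimately show "definite_minors A \<and> definite_minors (row_cons e A) \<and>
      positively_oriented N ?V ((\<lambda>v. v + e) ` ?V)"
      using po by (auto simp: definite_minors_def)
  next
    assume *: "definite_minors A \<and> definite_minors (row_cons e A) \<and>
      positively_oriented N ?V ((\<lambda>v. v + e) ` ?V)"
    then obtain s t where s: "s \<noteq> 0" "pos_minors s A" and t: "t \<noteq> 0" "pos_minors t (row_cons e A)"
      by (auto simp: definite_minors_def)
    have "s * t > 0" using sign[OF s(2) t(2)] * po by (simp add: zero_less_mult_iff)
    \<comment> \<open>Factors of equal sign have a positive ratio, and rescaling by it replaces
      \<open>s\<close> by \<open>t\<close>.\<close>
    then have "t / s > 0" by (auto simp: zero_less_mult_iff zero_less_divide_iff)
    then have "pos_minors t A" using pos_minors_scale[OF _ s(2), of "t / s"] s(1) by simp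
    with t show "coherent A e" by (auto simp: coherent_def)
  qed
qed

text \<open>The bordered matrix and the alternated graph span orthogonal complements, of dimensions
  \<open>m + 1\<close> and \<open>r\<close> in \<open>N + 1\<close> coordinates. Definiteness of the
  border is coherence.\<close>

lemma definite_left_graph_iff_coherent:
  assumes A: "A \<in> carrier_mat m N" and B: "B \<in> carrier_mat r N" and N: "N = m + r"
    and orth: "A * B\<^sup>T = 0\<^sub>m m r" and rkA: "det (A * A\<^sup>T) \<noteq> 0" and rkB: "det (B * B\<^sup>T) \<noteq> 0"
    and e: "e \<in> carrier_vec N"
  shows "definite_minors (left_graph (alt e) (alt_mat B)) \<longleftrightarrow> coherent A e"
proof -
  let ?L = "left_graph (alt e) (alt_mat B)"
  have ae: "alt e = vec N (\<lambda>l. (-1) ^ l * e $ l)" using e by (simp add: alt_def)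
  \<comment> \<open>Duality alternates the complement; taking it already alternated makes the two
    alternations cancel.\<close>
  have "definite_minors (left_border e A) \<longleftrightarrow> definite_minors (alt_mat (alt_mat ?L))"
  proof (rule definite_minors_dual)
    show "left_border e A * (alt_mat ?L)\<^sup>T = 0\<^sub>m (Suc m) r"
      unfolding ae by (rule left_border_left_graph_orthogonal[OF A B e orth])
    show "det (left_border e A * (left_border e A)\<^sup>T) \<noteq> 0" by (rule gram_det_left_border[OF A rkA])
    show "det (alt_mat ?L * (alt_mat ?L)\<^sup>T) \<noteq> 0"
      unfolding gram_alt_mat by (rule gram_det_left_graph) (use B rkB e in \<open>auto simp: gram_alt_mat\<close>)
  qed (use A B N in auto)
  then show ?thesis by (simp add: definite_minors_def coherent_def pos_minors_left_border[OF A])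
qed

text \<open>The same duality with the roles exchanged: the graph lies over the row space of
  \<open>A\<close>, the border over that of \<open>alt_mat B\<close>.\<close>

lemma definite_right_graph_iff_coherent:
  assumes A: "A \<in> carrier_mat m N" and B: "B \<in> carrier_mat r N" and N: "N = m + r"
    and orth: "A * B\<^sup>T = 0\<^sub>m m r" and rkA: "det (A * A\<^sup>T) \<noteq> 0" and rkB: "det (B * B\<^sup>T) \<noteq> 0"
    and x: "x \<in> carrier_vec N"
  shows "definite_minors (right_graph ((-1) ^ m \<cdot>\<^sub>v x) A) \<longleftrightarrow> coherent (alt_mat B) (- alt x)"
proof -
  let ?T = "right_border (- alt x) (alt_mat B)"
  have B': "alt_mat B \<in> carrier_mat r N" using B by simp
  have ax: "- alt x = vec N (\<lambda>l. - ((-1) ^ l * x $ l))" using x by (auto simp: alt_def)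
  have "definite_minors (right_graph ((-1) ^ m \<cdot>\<^sub>v x) A) \<longleftrightarrow> definite_minors (alt_mat (alt_mat ?T))"
  proof (rule definite_minors_dual)
    show "right_graph ((-1) ^ m \<cdot>\<^sub>v x) A * (alt_mat ?T)\<^sup>T = 0\<^sub>m m (Suc r)"
      unfolding ax by (rule right_graph_right_border_orthogonal[OF A B x N orth])
    show "det (right_graph ((-1) ^ m \<cdot>\<^sub>v x) A * (right_graph ((-1) ^ m \<cdot>\<^sub>v x) A)\<^sup>T) \<noteq> 0"
      by (rule gram_det_right_graph[OF A rkA]) (use x in simp)
    show "det (alt_mat ?T * (alt_mat ?T)\<^sup>T) \<noteq> 0"
      unfolding gram_alt_mat by (rule gram_det_right_border[OF B']) (use rkB in \<open>simp add: gram_alt_mat\<close>)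
  qed (use A B N in auto)
  then show ?thesis by (simp add: definite_minors_def coherent_def pos_minors_right_border[OF B'])
qed

section \<open>Cyclicity under alt Gale duality\<close>

lemma nonzero_entries_alt[simp]: "nonzero_entries (alt v) = nonzero_entries v"
  unfolding nonzero_entries_def by (rule arg_cong[where f = card]) auto

lemma nonzero_entries_uminus[simp]: "nonzero_entries (- v) = nonzero_entries v"
  unfolding nonzero_entries_def by (rule arg_cong[where f = card]) auto

theorem theorem3p27:
  fixes n k :: nat and V \<eta> \<xi> :: "real vec set"
  assumes "polarized_arrangement n k (V, \<eta>, \<xi>)"
    and "0 < k" and "k < n"
  shows "polarization_reversal (alt_gale_dual n (V, \<eta>, \<xi>)) =
      (alt ` perp n V, uminus ` alt ` \<xi>, alt ` \<eta>) \<and>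
    polarized_arrangement n (n - k) (alt ` perp n V, uminus ` alt ` \<xi>, alt ` \<eta>) \<and>
    (right_cyclic n k (V, \<eta>, \<xi>) \<longleftrightarrow>
     left_cyclic n (n - k) (polarization_reversal (alt_gale_dual n (V, \<eta>, \<xi>))))"
proof -
  define d where "d = n - k"
  \<comment> \<open>Both extended spaces must fit into \<open>n\<close> coordinates. At the ends of
    the range the equivalence can fail: for \<open>k = 0\<close> left cyclicity of the dual would
    require a subspace of dimension \<open>n + 1\<close>, while right cyclicity may hold.\<close>
  have n: "n = k + d" "n = d + k" and le: "Suc k \<le> n" "Suc d \<le> n"
    using assms(2,3) by (auto simp: d_def)
  have Gr: "V \<in> Gr k n" and cosets: "\<eta> \<in> a_rcosets\<^bsub>Rn n\<^esub> V" "\<xi> \<in> a_rcosets\<^bsub>Rn n\<^esub> (perp n V)"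
    and nz: "\<forall>e \<in> \<eta>. nonzero_entries e \<ge> n - k" "\<forall>x \<in> \<xi>. nonzero_entries x \<ge> k"
    using assms(1) by auto
  obtain A where A: "A \<in> carrier_mat k n" and VA: "vec_space.row_space n A = V" and rkA: "det (A * A\<^sup>T) \<noteq> 0"
    using Gr_obtain_basis[OF Gr] by blast
  obtain B where B: "B \<in> carrier_mat d n" and orth: "A * B\<^sup>T = 0\<^sub>m k d" and rkB: "det (B * B\<^sup>T) \<noteq> 0"
    using complement_matrix_exists[of A k d] A rkA n(1) by auto
  have "B * A\<^sup>T = (A * B\<^sup>T)\<^sup>T" using A B by (simp add: transpose_mult[of _ k n])
  then have orth': "B * A\<^sup>T = 0\<^sub>m d k" unfolding orth by simp
  have PB: "perp n V = vec_space.row_space n B"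
    unfolding VA[symmetric] by (rule perp_row_space_complement[OF A B n(1) orth rkA rkB])
  \<comment> \<open>The double complement turns cosets of \<open>V\<close> into functionals on
    \<open>perp n V\<close>, as the dual triple requires.\<close>
  have PP: "perp n (perp n V) = V"
    unfolding PB unfolding VA[symmetric] by (rule perp_row_space_complement[OF B A n(2) orth' rkB rkA])
  define B' where "B' = alt_mat B"
  have B': "B' \<in> carrier_mat d n" and rkB': "det (B' * B'\<^sup>T) \<noteq> 0"
    using B rkB by (simp_all add: B'_def gram_alt_mat)
  define V' where "V' = alt ` perp n V"
  have VB': "vec_space.row_space n B' = V'" by (simp add: B'_def row_space_alt_mat[OF B] V'_def PB)
  have Vc: "V \<subseteq> carrier_vec n" and V'c: "V' \<subseteq> carrier_vec n" and perpc: "perp n V \<subseteq> carrier_vec n"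
    using A B' by (auto simp: VA[symmetric] VB'[symmetric] row_space_conv[OF A] row_space_conv[OF B'] perp_conv)
  have PV': "perp n V' = alt ` V" using perp_alt[OF perpc] PP by (simp add: V'_def)
  obtain e where e: "e \<in> carrier_vec n" and \<eta>: "\<eta> = (\<lambda>v. v + e) ` V" using cosets(1) by (auto simp: a_rcosets_conv)
  obtain x where x: "x \<in> carrier_vec n" and \<xi>: "\<xi> = (\<lambda>w. w + x) ` perp n V" using cosets(2) by (auto simp: a_rcosets_conv)
  have alt_\<eta>: "alt ` \<eta> = (\<lambda>v. v + alt e) ` perp n V'"
    unfolding \<eta> PV' image_image by (rule image_cong) (use Vc e in \<open>auto intro!: alt_add\<close>)
  \<comment> \<open>As \<open>perp n V\<close> is closed under negation, the sign of the coset can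
    be moved to its representative alone.\<close>
  have "- w \<in> perp n V" if "w \<in> perp n V" for w
    using that Vc by (auto simp: perp_conv)
  then have neg: "uminus ` perp n V = perp n V"
    by (force intro: image_eqI[of _ uminus "- _"])
  have "uminus ` alt ` \<xi> = (\<lambda>w. alt (- w) + (- alt x)) ` perp n V"
    unfolding \<xi> image_image
  proof (rule image_cong)
    fix w assume "w \<in> perp n V"
    then have "w \<in> carrier_vec n" using perpc by blast
    then show "- alt (w + x) = alt (- w) + - alt x" using x by (intro eq_vecI) (auto simp: algebra_simps)
  qed simp
  also have "\<dots> = (\<lambda>w. alt w + (- alt x)) ` uminus ` perp n V" by (simp add: image_image)
  also have "\<dots> = (\<lambda>w. w + (- alt x)) ` V'" unfolding neg by (simp add: V'_def image_image)
  finally have alt_\<xi>: "uminus ` alt ` \<xi> = (\<lambda>w. w + (- alt x)) ` V'" .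
  have reversal: "polarization_reversal (alt_gale_dual n (V, \<eta>, \<xi>)) = (V', uminus ` alt ` \<xi>, alt ` \<eta>)"
    by (simp add: V'_def image_image)
  have polarized: "polarized_arrangement n d (V', uminus ` alt ` \<xi>, alt ` \<eta>)"
  proof -
    have "V' \<in> Gr d n" unfolding VB'[symmetric] by (rule row_space_in_Gr[OF B' rkB'])
    moreover have "uminus ` alt ` \<xi> \<in> a_rcosets\<^bsub>Rn n\<^esub> V'" "alt ` \<eta> \<in> a_rcosets\<^bsub>Rn n\<^esub> (perp n V')"
      unfolding a_rcosets_conv alt_\<xi> alt_\<eta> using x e by auto
    \<comment> \<open>Passing to the dual exchanges the two bounds on nonzero entries, and neither
      negation nor \<open>alt\<close> affects the counts.\<close>
    moreover have "n - d = k" "n - k = d" using n by simp_all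
    ultimately show ?thesis using nz by auto
  qed
  have extend: "extend n V \<eta> = vec_space.row_space n (row_cons e A)"
    "extend n V' (uminus ` alt ` \<xi>) = vec_space.row_space n (row_cons (- alt x) B')"
    unfolding \<eta> alt_\<xi> using extend_row_space[OF A e] extend_row_space[OF B', of "- alt x"] x by (simp_all add: VA VB')
  have "{v @\<^sub>v vec_of_list [(-1) ^ k * pairing \<xi> v] | v. v \<in> V} =
    (\<lambda>v. v @\<^sub>v vec_of_list [((-1) ^ k \<cdot>\<^sub>v x) \<bullet> v]) ` V"
    unfolding \<xi> Setcompr_eq_image
  proof (rule image_cong)
    fix v assume v: "v \<in> V"
    then have "v \<in> carrier_vec n" using Vc by blast
    then show "v @\<^sub>v vec_of_list [(-1) ^ k * pairing ((\<lambda>w. w + x) ` perp n V) v] =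
        v @\<^sub>v vec_of_list [((-1) ^ k \<cdot>\<^sub>v x) \<bullet> v]"
      using x by (simp add: pairing_eq[OF Vc v x])
  qed simp
  also have "\<dots> = vec_space.row_space (Suc n) (right_graph ((-1) ^ k \<cdot>\<^sub>v x) A)"
    by (subst row_space_right_graph[OF A]) (use x VA in auto)
  finally have right: "{v @\<^sub>v vec_of_list [(-1) ^ k * pairing \<xi> v] | v. v \<in> V} =
    vec_space.row_space (Suc n) (right_graph ((-1) ^ k \<cdot>\<^sub>v x) A)" .
  have "{vCons (pairing (alt ` \<eta>) v) v | v. v \<in> V'} = (\<lambda>v. vCons (alt e \<bullet> v) v) ` V'"
    unfolding alt_\<eta> Setcompr_eq_image using pairing_eq[OF V'c, of _ "alt e"] e by (intro image_cong) auto
  also have "\<dots> = vec_space.row_space (Suc n) (left_graph (alt e) B')"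
    by (subst row_space_left_graph[OF B']) (use e VB' in auto)
  finally have left: "{vCons (pairing (alt ` \<eta>) v) v | v. v \<in> V'} =
    vec_space.row_space (Suc n) (left_graph (alt e) B')" .
  have Gr_pos: "vec_space.row_space N M \<in> Gr_pos m N \<longleftrightarrow> definite_minors M"
    if "M \<in> carrier_mat m N" "m \<le> N" for M m N
    using row_space_in_Gr_pos_iff[OF that] by (simp add: definite_minors_def)
  have coherent_A: "coherent A e \<longleftrightarrow>
    definite_minors A \<and> definite_minors (row_cons e A) \<and> positively_oriented n V \<eta>"
    unfolding \<eta> using coherent_iff[OF A le(1) rkA e] by (simp only: VA)
  have coherent_B': "coherent B' (- alt x) \<longleftrightarrow> definite_minors B' \<and>
    definite_minors (row_cons (- alt x) B') \<and> positively_oriented n V' (uminus ` alt ` \<xi>)"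
    unfolding alt_\<xi> using coherent_iff[OF B' le(2) rkB', of "- alt x"] x by (simp add: VB')
  have "right_cyclic n k (V, \<eta>, \<xi>) \<longleftrightarrow> definite_minors (row_cons e A) \<and>
    definite_minors (right_graph ((-1) ^ k \<cdot>\<^sub>v x) A) \<and> positively_oriented n V \<eta>"
    using assms(1) A le unfolding right_cyclic.simps extend right
    by (simp add: Gr_pos[of _ "Suc k" n] Gr_pos[of _ k "Suc n"] del: polarized_arrangement.simps)
  also have "definite_minors (right_graph ((-1) ^ k \<cdot>\<^sub>v x) A) \<longleftrightarrow> coherent B' (- alt x)"
    unfolding B'_def by (rule definite_right_graph_iff_coherent[OF A B n(1) orth rkA rkB x])
  finally have R: "right_cyclic n k (V, \<eta>, \<xi>) \<longleftrightarrow>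
    definite_minors (row_cons e A) \<and> coherent B' (- alt x) \<and> positively_oriented n V \<eta>" .
  have "left_cyclic n d (V', uminus ` alt ` \<xi>, alt ` \<eta>) \<longleftrightarrow> definite_minors (row_cons (- alt x) B') \<and>
    definite_minors (left_graph (alt e) B') \<and> positively_oriented n V' (uminus ` alt ` \<xi>)"
    using polarized B' le unfolding left_cyclic.simps extend left
    by (simp add: Gr_pos[of _ "Suc d" n] Gr_pos[of _ d "Suc n"] del: polarized_arrangement.simps)
  also have "definite_minors (left_graph (alt e) B') \<longleftrightarrow> coherent A e"
    unfolding B'_def by (rule definite_left_graph_iff_coherent[OF A B n(1) orth rkA rkB e])
  finally have L: "left_cyclic n d (V', uminus ` alt ` \<xi>, alt ` \<eta>) \<longleftrightarrow>
    definite_minors (row_cons (- alt x) B') \<and> coherent A e \<and> positively_oriented n V' (uminus ` alt ` \<xi>)" .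
  \<comment> \<open>Each side consists of one coherence and, for the other pair, definiteness of the
    extended space and orientation. The definiteness of the space itself, still missing there, is
    carried over by this equivalence from the pair known to be coherent.\<close>
  have "definite_minors A \<longleftrightarrow> definite_minors B'"
    unfolding B'_def by (rule definite_minors_dual[OF A B n(1) orth rkA rkB])
  then have "right_cyclic n k (V, \<eta>, \<xi>) \<longleftrightarrow> left_cyclic n d (V', uminus ` alt ` \<xi>, alt ` \<eta>)"
    using R L coherent_A coherent_B' by blast
  then show ?thesis using reversal polarized unfolding V'_def d_def by metis
qed

end
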